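(* For every constant $\varepsilon>0$, there is a polynomial-time mapping reduction from $\forall\exists$-NAE-E3-SAT to $(9/8-\varepsilon)$-$\mathrm{BinGapCRP}_\infty$.
   Context: An NAE-E3-SAT formula has constraints each a function of exactly $3$ literals on distinct variables, a constraint being satisfied iff its literals do not all evaluate to the same value. $\forall\exists$-NAE-E3-SAT is the problem: given an NAE-E3-SAT formula $\phi(V_A,V_E)$ over the disjoint union of variable sets $V_A$ and $V_E$, distinguish YES instances, in which for every assignment $\psi_A:V_A\to\{0,1\}$ there exists $\psi_E:V_E\to\{0,1\}$ such that $(\psi_A,\psi_E)$ satisfies all constraints of $\phi$, from NO instances, in which there exists $\psi_A$ such that no $\psi_E$ makes $(\psi_A,\psi_E)$ satisfy all constraints. For $B\in\mathbb{R}^{m\times n}$, $\mathrm{lindisc}_\infty(B):=\max_{w\in[0,1]^n}\min_{x\in\{0,1\}^n}\|B(w-x)\|_\infty$; for a basis $B$ (full column rank), $\mu_\infty(\mathcal{L}(B)):=\max_{w\in[0,1]^n}\min_{x\in\mathbb{Z}^n}\|B(w-x)\|_\infty$. $\gamma$-$\mathrm{BinGapCRP}_\infty$ is the promise problem: given a basis $B$ and $r>0$, distinguish YES instances with $\mathrm{lindisc}_\infty(B)\le r$ from NO instances with $\mu_\infty(\mathcal{L}(B))>\gamma r$. *)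

theory Defs
  imports "HOL-Computational_Algebra.Polynomial" "Jordan_Normal_Form.DL_Rank"
begin

section \<open>Polynomial-time computable functions on bit strings\<close>

text \<open>
  Deterministic multi-tape Turing machines with two-way infinite tapes. Control states and tape
  symbols are natural numbers drawn from finite sets; symbol \<open>0\<close> is the blank, and \<open>1\<close>, \<open>2\<close>
  are the bits 0 and 1.
\<close>

datatype dir = Lt | Stay | Rt

record tm =
  tape_count :: nat
  states :: "nat set"
  symbols :: "nat set"
  start :: nat
  halt :: nat
  delta :: "nat \<Rightarrow> nat list \<Rightarrow> nat \<times> (nat \<times> dir) list"

definition wf_tm :: "tm \<Rightarrow> bool" where
  "wf_tm M \<longleftrightarrow>
     tape_count M \<ge> 1 \<and> finite (states M) \<and> finite (symbols M) \<and>
     {0, 1, 2} \<subseteq> symbols M \<and> start M \<in> states M \<and> halt M \<in> states M \<and>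
     (\<forall>q \<in> states M. \<forall>ss. length ss = tape_count M \<and> set ss \<subseteq> symbols M \<longrightarrow>
        fst (delta M q ss) \<in> states M \<and>
        length (snd (delta M q ss)) = tape_count M \<and>
        fst ` set (snd (delta M q ss)) \<subseteq> symbols M)"

text \<open>A tape is its contents together with the head position.\<close>

type_synonym tape = "(int \<Rightarrow> nat) \<times> int"
type_synonym config = "nat \<times> tape list"

definition read_tape :: "tape \<Rightarrow> nat" where
  "read_tape t = fst t (snd t)"

fun offset :: "dir \<Rightarrow> int" where
  "offset Lt = -1"
| "offset Stay = 0"
| "offset Rt = 1"

definition act :: "nat \<times> dir \<Rightarrow> tape \<Rightarrow> tape" where
  "act a t = ((fst t)(snd t := fst a), snd t + offset (snd a))"

definition tm_step :: "tm \<Rightarrow> config \<Rightarrow> config" where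
  "tm_step M c =
     (if fst c = halt M then c
      else let d = delta M (fst c) (map read_tape (snd c))
           in (fst d, map2 act (snd d) (snd c)))"

definition contents :: "bool list \<Rightarrow> int \<Rightarrow> nat" where
  "contents x i = (if 0 \<le> i \<and> nat i < length x then (if x ! nat i then 2 else 1) else 0)"

text \<open>The input is on the first tape, the output is read off the last one.\<close>

definition init_config :: "tm \<Rightarrow> bool list \<Rightarrow> config" where
  "init_config M x = (start M, (contents x, 0) # replicate (tape_count M - 1) (contents [], 0))"

definition computes_within :: "tm \<Rightarrow> (bool list \<Rightarrow> bool list) \<Rightarrow> (nat \<Rightarrow> nat) \<Rightarrow> bool" where
  "computes_within M f T \<longleftrightarrow>
     (\<forall>x. \<exists>t \<le> T (length x).
        let c = (tm_step M ^^ t) (init_config M x)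
        in fst c = halt M \<and> fst (last (snd c)) = contents (f x))"

definition polytime :: "(bool list \<Rightarrow> bool list) \<Rightarrow> bool" where
  "polytime f \<longleftrightarrow> (\<exists>M (p :: nat poly). wf_tm M \<and> computes_within M f (poly p))"

text \<open>A promise problem is the pair of its sets of (encoded) YES and NO instances.\<close>

type_synonym promise_problem = "bool list set \<times> bool list set"

definition polytime_reducible :: "promise_problem \<Rightarrow> promise_problem \<Rightarrow> bool" where
  "polytime_reducible P Q \<longleftrightarrow>
     (\<exists>f. polytime f \<and> (\<forall>x \<in> fst P. f x \<in> fst Q) \<and> (\<forall>x \<in> snd P. f x \<in> snd Q))"

section \<open>Self-delimiting encodings\<close>

definition enc_unary :: "nat \<Rightarrow> bool list" where
  "enc_unary n = replicate n True @ [False]"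

definition enc_list :: "('a \<Rightarrow> bool list) \<Rightarrow> 'a list \<Rightarrow> bool list" where
  "enc_list enc xs = concat (map (\<lambda>x. True # enc x) xs) @ [False]"

fun bits :: "nat \<Rightarrow> bool list" where
  "bits n = (if n = 0 then [] else odd n # bits (n div 2))"

declare bits.simps [simp del]

definition enc_nat :: "nat \<Rightarrow> bool list" where
  "enc_nat n = enc_list (\<lambda>b. [b]) (bits n)"

definition enc_int :: "int \<Rightarrow> bool list" where
  "enc_int z = (z < 0) # enc_nat (nat \<bar>z\<bar>)"

definition enc_rat :: "rat \<Rightarrow> bool list" where
  "enc_rat q = enc_int (fst (quotient_of q)) @ enc_int (snd (quotient_of q))"

section \<open>The problem $\forall\exists$-NAE-E3-SAT\<close>

text \<open>
  \<open>V\<^sub>A\<close> is \<open>{..<a}\<close> and \<open>V\<^sub>E\<close> is \<open>{..<e}\<close>; a variable is an element of their disjoint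
  union, \<open>Inl i\<close> being universal and \<open>Inr j\<close> existential. The literal \<open>(v, True)\<close> is the
  variable \<open>v\<close> and \<open>(v, False)\<close> is its negation.
\<close>

type_synonym var = "nat + nat"
type_synonym literal = "var \<times> bool"
type_synonym nae_constraint = "literal list"

record nae_formula =
  num_univ :: nat
  num_exis :: nat
  constraints :: "nae_constraint list"

definition nae_e3_formula :: "nae_formula \<Rightarrow> bool" where
  "nae_e3_formula \<phi> \<longleftrightarrow>
     (\<forall>c \<in> set (constraints \<phi>). length c = 3 \<and> distinct (map fst c) \<and>
        fst ` set c \<subseteq> {..<num_univ \<phi>} <+> {..<num_exis \<phi>})"

definition eval_literal :: "(var \<Rightarrow> bool) \<Rightarrow> literal \<Rightarrow> bool" where
  "eval_literal \<psi> l = (if snd l then \<psi> (fst l) else \<not> \<psi> (fst l))"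

definition satisfies :: "(var \<Rightarrow> bool) \<Rightarrow> nae_formula \<Rightarrow> bool" where
  "satisfies \<psi> \<phi> \<longleftrightarrow>
     (\<forall>c \<in> set (constraints \<phi>). \<not> (\<exists>b. \<forall>l \<in> set c. eval_literal \<psi> l = b))"

text \<open>
  Assignments are total functions; \<^term>\<open>satisfies\<close> only depends on their values on
  \<open>V\<^sub>A\<close> and \<open>V\<^sub>E\<close>.
\<close>

definition forall_exists_sat :: "nae_formula \<Rightarrow> bool" where
  "forall_exists_sat \<phi> \<longleftrightarrow> (\<forall>\<psi>\<^sub>A. \<exists>\<psi>\<^sub>E. satisfies (case_sum \<psi>\<^sub>A \<psi>\<^sub>E) \<phi>)"

definition enc_var :: "var \<Rightarrow> bool list" where
  "enc_var v = (case v of Inl i \<Rightarrow> False # enc_unary i | Inr j \<Rightarrow> True # enc_unary j)"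

definition enc_literal :: "literal \<Rightarrow> bool list" where
  "enc_literal l = enc_var (fst l) @ [snd l]"

text \<open>
  Variable counts and indices are written in unary, so that the length of the code word is at
  least the number of variables.
\<close>

definition enc_formula :: "nae_formula \<Rightarrow> bool list" where
  "enc_formula \<phi> = enc_unary (num_univ \<phi>) @ enc_unary (num_exis \<phi>) @
     enc_list (enc_list enc_literal) (constraints \<phi>)"

definition forall_exists_nae_e3_sat :: promise_problem where
  "forall_exists_nae_e3_sat =
     (enc_formula ` {\<phi>. nae_e3_formula \<phi> \<and> forall_exists_sat \<phi>},
      enc_formula ` {\<phi>. nae_e3_formula \<phi> \<and> \<not> forall_exists_sat \<phi>})"

section \<open>Linear discrepancy, covering radius and BinGapCRP\<close>

definition linf_norm :: "real vec \<Rightarrow> real" where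
  "linf_norm v = Max (insert 0 {\<bar>v $ i\<bar> | i. i < dim_vec v})"

definition unit_cube :: "nat \<Rightarrow> real vec set" where
  "unit_cube n = {w \<in> carrier_vec n. \<forall>i < n. 0 \<le> w $ i \<and> w $ i \<le> 1}"

definition binary_vecs :: "nat \<Rightarrow> real vec set" where
  "binary_vecs n = {x \<in> carrier_vec n. \<forall>i < n. x $ i \<in> {0, 1}}"

definition int_vecs :: "nat \<Rightarrow> real vec set" where
  "int_vecs n = {x \<in> carrier_vec n. \<forall>i < n. x $ i \<in> \<int>}"

text \<open>
  The maxima and minima of the literature are written as suprema and infima. The sets involved
  are nonempty and bounded (norms are nonnegative, and each infimum lies between \<open>0\<close> and \<open>linf_norm (B *\<^sub>v w)\<close>), so
  the real \<^term>\<open>Sup\<close> and \<^term>\<open>Inf\<close> are meaningful.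
\<close>

definition lindisc :: "real mat \<Rightarrow> real" where
  "lindisc B = (SUP w \<in> unit_cube (dim_col B). INF x \<in> binary_vecs (dim_col B).
     linf_norm (B *\<^sub>v (w - x)))"

definition covering_radius :: "real mat \<Rightarrow> real" where
  "covering_radius B = (SUP w \<in> unit_cube (dim_col B). INF x \<in> int_vecs (dim_col B).
     linf_norm (B *\<^sub>v (w - x)))"

definition lattice_basis :: "real mat \<Rightarrow> bool" where
  "lattice_basis B \<longleftrightarrow> 0 < dim_col B \<and> vec_space.rank (dim_row B) B = dim_col B"

text \<open>Instances consist of a rational basis and a rational radius, written in binary.\<close>

definition enc_crp :: "rat mat \<times> rat \<Rightarrow> bool list" where
  "enc_crp I = enc_list (enc_list enc_rat) (mat_to_list (fst I)) @ enc_rat (snd I)"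

definition bin_gap_crp :: "real \<Rightarrow> promise_problem" where
  "bin_gap_crp \<gamma> =
     (enc_crp ` {(B, r). lattice_basis (map_mat of_rat B) \<and> 0 < r \<and>
        lindisc (map_mat of_rat B) \<le> of_rat r},
      enc_crp ` {(B, r). lattice_basis (map_mat of_rat B) \<and> 0 < r \<and>
        covering_radius (map_mat of_rat B) > \<gamma> * of_rat r})"

end

theory Submission
  imports Defs
begin

text \<open>
  The truth value of a variable is encoded by the parity of the rounding of a triple of columns.
  Call a sign vector even if it has an even number of minus signs. For every \<open>w\<close> in the cube
  \<open>[0,1]^3\<close> there is a binary \<open>x\<close> such that \<open>y = w - x\<close> satisfies \<open>-1 \<le> e \<bullet> y \<le> 3/2\<close> for all four even
  \<open>e\<close>; call such a \<open>y\<close> true, and its negative false. By contrast, at \<open>w = (1/2, 1/2, 1/2)\<close> every binary \<open>x\<close> makes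
  \<open>e \<bullet> y\<close> equal to \<open>3/2\<close> or \<open>-3/2\<close> for one even \<open>e\<close>, the sign being that of \<open>y\<^sub>0 y\<^sub>1 y\<^sub>2\<close>. For a
  constraint, take as rows the sums of the three forms \<open>\<plusminus> e \<bullet> y\<close> (the sign is that of the literal)
  over all triples of even \<open>e\<close>: if the literals are not all equal, each sum is at most
  \<open>3/2 + 3/2 + 1 = 4\<close> in absolute value, and if they are all equal, then at \<open>w = 1/2\<close> some sum reaches
  \<open>9/2\<close>. The ratio is \<open>9/8\<close>. The value of a universal variable is dictated by \<open>w\<close> through a fourth
  column, the decider, which is rounded to the nearest integer and whose sign is linked to the parity of the triple.
\<close>

section \<open>Turing machines from loop programs\<close>

text \<open>A single column per variable gives no gap: an interval [-s, t] of values granted to a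
  true variable has to meet {w, w - 1} for every w, so s + t >= 1, and t >= 1/2 if y = 1/2 is to
  count as true. Two true literals and a false one are then bounded only by 2t + s >= 3/2, which is
  all that three equal literals yield at w = 1/2. Triples have s = 1 < t = 3/2, so that 2t + s = 4 <
  9/2. The covering radius ranges over all integer x, but the parity argument concerns binary x. Box
  rows, one per column, rule out the other integers: weight 4 suits entries up to 1 in absolute
  value, weight 8 a decider that is rounded to the nearest integer. They also make the columns
  independent. The critical point cannot have its deciders at 1/2, where either rounding would be
  equally cheap; at 7/16 and 9/16 the wrong rounding costs exactly 9/2. The machine has to halt in
  polynomial time on every bit string, not only on encodings; hence the saturating moves and
  truncated indices in the programs.\<close>

text \<open>
  Programs work on three tapes: the input, which is scanned from left to right, a work tape and an
  output tape, to which bits are appended. Tests see the symbols under the first two heads.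
\<close>

datatype cmd =
    Advance
  | Emit bool
  | Shift dir
  | Write "nat \<Rightarrow> nat"
  | Seq cmd cmd
  | Cond "nat \<Rightarrow> nat \<Rightarrow> bool" cmd cmd
  | Loop "nat \<Rightarrow> nat \<Rightarrow> bool" cmd

text \<open>
  The control state of the machine is the stack of commands that remain to be executed. Only
  finitely many stacks are reachable, so that they can be numbered.
\<close>

definition keep :: "nat list \<Rightarrow> (nat \<times> dir) list" where
  "keep ss = map (\<lambda>s. (s, Stay)) ss"

text \<open>\<open>min 31\<close> confines an arbitrary \<open>f\<close> to the alphabet
  \<open>{..<32}\<close>. Composite commands spend one step on rewriting the stack and leave the
  tapes alone; a loop pushes itself below its body, so the stack does not grow with the number of
  iterations.\<close>

fun next_cmd :: "cmd list \<Rightarrow> nat list \<Rightarrow> cmd list \<times> (nat \<times> dir) list" where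
  "next_cmd [] ss = ([], keep ss)"
| "next_cmd (Advance # K) ss = (K, [(ss ! 0, Rt), (ss ! 1, Stay), (ss ! 2, Stay)])"
| "next_cmd (Emit b # K) ss = (K, [(ss ! 0, Stay), (ss ! 1, Stay), (if b then 2 else 1, Rt)])"
| "next_cmd (Shift d # K) ss = (K, [(ss ! 0, Stay), (ss ! 1, d), (ss ! 2, Stay)])"
| "next_cmd (Write f # K) ss = (K, [(ss ! 0, Stay), (min 31 (f (ss ! 1)), Stay), (ss ! 2, Stay)])"
| "next_cmd (Seq c d # K) ss = (c # d # K, keep ss)"
| "next_cmd (Cond p c d # K) ss = ((if p (ss ! 0) (ss ! 1) then c else d) # K, keep ss)"
| "next_cmd (Loop p c # K) ss = ((if p (ss ! 0) (ss ! 1) then c # Loop p c # K else K), keep ss)"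

text \<open>The stacks met while \<open>c\<close> is executed on top of \<open>K\<close>, with
  \<open>K\<close> itself left out. The body of a loop runs on top of the loop's own stack, which is
  already counted; this is why recursion on \<open>c\<close> suffices and the set is finite.\<close>

primrec stacks :: "cmd \<Rightarrow> cmd list \<Rightarrow> cmd list set" where
  "stacks Advance K = {Advance # K}"
| "stacks (Emit b) K = {Emit b # K}"
| "stacks (Shift d) K = {Shift d # K}"
| "stacks (Write f) K = {Write f # K}"
| "stacks (Seq c d) K = insert (Seq c d # K) (stacks c (d # K) \<union> stacks d K)"
| "stacks (Cond p c d) K = insert (Cond p c d # K) (stacks c K \<union> stacks d K)"
| "stacks (Loop p c) K = insert (Loop p c # K) (stacks c (Loop p c # K))"

lemma finite_stacks: "finite (stacks c K)"
  by (induction c arbitrary: K) auto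

lemma stacks_self: "c # K \<in> stacks c K"
  by (cases c) auto

lemma stacks_closed: "k \<in> stacks c K \<Longrightarrow> fst (next_cmd k ss) \<in> insert K (stacks c K)"
proof (induction c arbitrary: K)
  case (Seq c d)
  then show ?case using stacks_self[of c "d # K"] stacks_self[of d K] by fastforce
next
  case (Cond p c d)
  then show ?case using stacks_self[of c K] stacks_self[of d K]
    by (auto split: if_splits dest: Cond.IH)
next
  case (Loop p c)
  then show ?case using stacks_self[of c "Loop p c # K"] by fastforce
qed auto

definition cmd_step :: "cmd list \<times> tape list \<Rightarrow> cmd list \<times> tape list" where
  "cmd_step c = (if fst c = [] then c
     else let d = next_cmd (fst c) (map read_tape (snd c)) in (fst d, map2 act (snd d) (snd c)))"

lemma length_next_cmd: "length ss = 3 \<Longrightarrow> length (snd (next_cmd k ss)) = 3"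
  by (cases "(k, ss)" rule: next_cmd.cases) (auto simp: keep_def)

lemma symbols_next_cmd:
  assumes "length ss = 3" "set ss \<subseteq> {..<32}"
  shows "fst ` set (snd (next_cmd k ss)) \<subseteq> {..<32}"
proof -
  have "ss ! 0 < 32" "ss ! 1 < 32" "ss ! 2 < 32" using assms by (auto simp: subset_iff)
  then show ?thesis using assms
    by (cases "(k, ss)" rule: next_cmd.cases) (auto simp: keep_def)
qed

definition start_tapes :: "bool list \<Rightarrow> tape list" where
  "start_tapes x = [(contents x, 0), (contents [], 0), (contents [], 0)]"

text \<open>Machine and program run in lockstep once the stacks are numbered by an injection
  \<open>e\<close>. The empty stack becomes the halting state, and both step functions leave such
  configurations unchanged.\<close>

theorem polytime_cmd:
  fixes p :: "nat poly"
  assumes run: "\<And>x. \<exists>n ts. n \<le> poly p (length x) \<and>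
      (cmd_step ^^ n) ([c], start_tapes x) = ([], ts) \<and> fst (last ts) = contents (f x)"
  shows "polytime f"
proof -
  define Q where "Q = insert [] (stacks c [])"
  have fin: "finite Q" by (simp add: Q_def finite_stacks)
  obtain e :: "cmd list \<Rightarrow> nat" where inj: "inj_on e Q"
    using finite_imp_inj_to_nat_seg[OF fin] by blast
  have closed: "fst (next_cmd k ss) \<in> Q" if "k \<in> Q" for k ss
    using that stacks_closed[of k c "[]" ss] by (auto simp: Q_def)
  define M where "M = \<lparr>tape_count = 3, states = e ` Q, symbols = {..<32}, start = e [c],
      halt = e [], delta = (\<lambda>q ss. let d = next_cmd (inv_into Q e q) ss in (e (fst d), snd d))\<rparr>"
  have c_in: "[c] \<in> Q" "[] \<in> Q" using stacks_self[of c "[]"] by (auto simp: Q_def)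
  have syms: "a < 32" if "length ss = 3" "set ss \<subseteq> {..<32}" "(a, b) \<in> set (snd (next_cmd k ss))"
    for a b k ss
    using symbols_next_cmd[OF that(1,2), of k] that(3) by force
  have wf: "wf_tm M"
    unfolding wf_tm_def M_def using fin c_in closed
    by (auto simp: Let_def length_next_cmd inj intro: syms)
  have step: "tm_step M (e k, ts) = (e (fst (cmd_step (k, ts))), snd (cmd_step (k, ts)))"
    and step_in: "fst (cmd_step (k, ts)) \<in> Q" if "k \<in> Q" for k ts
  proof -
    have "e k = e [] \<longleftrightarrow> k = []" using inj_on_eq_iff[OF inj] that c_in by blast
    then show "tm_step M (e k, ts) = (e (fst (cmd_step (k, ts))), snd (cmd_step (k, ts)))"
      using that inj by (simp add: tm_step_def cmd_step_def M_def Let_def)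
    show "fst (cmd_step (k, ts)) \<in> Q"
      using that closed by (auto simp: cmd_step_def Let_def)
  qed
  have steps: "(tm_step M ^^ n) (e k, ts) =
      (e (fst ((cmd_step ^^ n) (k, ts))), snd ((cmd_step ^^ n) (k, ts))) \<and>
      fst ((cmd_step ^^ n) (k, ts)) \<in> Q" if "k \<in> Q" for n k ts
  proof (induction n)
    case (Suc n)
    then show ?case
      using step[of "fst ((cmd_step ^^ n) (k, ts))" "snd ((cmd_step ^^ n) (k, ts))"]
        step_in[of "fst ((cmd_step ^^ n) (k, ts))" "snd ((cmd_step ^^ n) (k, ts))"] by simp
  qed (use that in simp)
  have "computes_within M f (poly p)"
    unfolding computes_within_def
  proof
    fix x
    obtain n ts where n: "n \<le> poly p (length x)"
      "(cmd_step ^^ n) ([c], start_tapes x) = ([], ts)" "fst (last ts) = contents (f x)"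
      using run by blast
    have "init_config M x = (e [c], start_tapes x)"
      by (simp add: init_config_def M_def start_tapes_def numeral_2_eq_2)
    then show "\<exists>t\<le>poly p (length x). let c = (tm_step M ^^ t) (init_config M x)
        in fst c = halt M \<and> fst (last (snd c)) = contents (f x)"
      using steps[of "[c]" n "start_tapes x"] c_in n
      by (intro exI[of _ n]) (simp add: M_def)
  qed
  with wf show ?thesis unfolding polytime_def by blast
qed

section \<open>Commands as timed transformations of stores\<close>

text \<open>The output head always stands right after the bits written so far.\<close>

definition work_tape :: "nat list \<Rightarrow> int \<Rightarrow> nat" where
  "work_tape ps i = (if 0 \<le> i \<and> nat i < length ps then ps ! nat i else 0)"

type_synonym store = "nat \<times> nat list \<times> nat \<times> bool list"

fun tapes :: "bool list \<Rightarrow> store \<Rightarrow> tape list" where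
  "tapes x (h, ps, k, out) =
     [(contents x, int h), (work_tape ps, int k), (contents out, int (length out))]"

text \<open>The step count \<open>n\<close> is chosen before the continuation \<open>K\<close>, so
  that a run does not depend on what follows it and composes under \<open>Seq\<close> and
  \<open>Loop\<close>. Only an upper bound \<open>T\<close> is recorded, which lets running times be
  rounded up.\<close>

definition runs :: "bool list \<Rightarrow> cmd \<Rightarrow> store \<Rightarrow> nat \<Rightarrow> store \<Rightarrow> bool" where
  "runs x c s T s' \<longleftrightarrow>
     (\<exists>n\<le>T. \<forall>K. (cmd_step ^^ n) (c # K, tapes x s) = (K, tapes x s'))"

lemma runs_weaken: "runs x c s T s' \<Longrightarrow> T \<le> T' \<Longrightarrow> runs x c s T' s'"
  unfolding runs_def by (meson order_trans)

lemma runs_1I: "(\<And>K. cmd_step (c # K, tapes x s) = (K, tapes x s')) \<Longrightarrow> runs x c s 1 s'"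
  unfolding runs_def by (intro exI[of _ 1]) auto

lemma runs_prefix:
  assumes "\<And>K. cmd_step (c # K, tapes x s) = (d # K, tapes x s)" "runs x d s T s'"
  shows "runs x c s (Suc T) s'"
proof -
  obtain n where "n \<le> T" "\<And>K. (cmd_step ^^ n) (d # K, tapes x s) = (K, tapes x s')"
    using assms(2) unfolding runs_def by blast
  then show ?thesis using assms(1) unfolding runs_def
    by (intro exI[of _ "Suc n"]) (simp add: funpow_Suc_right del: funpow.simps)
qed

lemma contents_snoc: "contents (out @ [b]) = (contents out)(int (length out) := if b then 2 else 1)"
  by (auto simp: contents_def nth_append fun_eq_iff)

lemma work_tape_nth: "k < length ps \<Longrightarrow> work_tape ps (int k) = ps ! k"
  by (simp add: work_tape_def)

lemma act_stay: "act (read_tape t, Stay) t = t"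
  by (cases t) (simp add: act_def read_tape_def)

lemma runs_Advance: "runs x Advance (h, ps, k, out) 1 (Suc h, ps, k, out)"
  by (rule runs_1I) (simp add: cmd_step_def act_def read_tape_def)

lemma runs_Emit: "runs x (Emit b) (h, ps, k, out) 1 (h, ps, k, out @ [b])"
  by (rule runs_1I) (simp add: cmd_step_def act_def read_tape_def contents_snoc)

lemma runs_right: "runs x (Shift Rt) (h, ps, k, out) 1 (h, ps, Suc k, out)"
  by (rule runs_1I) (simp add: cmd_step_def act_def read_tape_def)

lemma runs_left: "runs x (Shift Lt) (h, ps, Suc k, out) 1 (h, ps, k, out)"
  by (rule runs_1I) (simp add: cmd_step_def act_def read_tape_def)

lemma runs_Write:
  assumes "k < length ps"
  shows "runs x (Write f) (h, ps, k, out) 1 (h, ps[k := min 31 (f (ps ! k))], k, out)"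
proof -
  have "work_tape (ps[k := v]) = (work_tape ps)(int k := v)" for v
    using assms by (auto simp: work_tape_def fun_eq_iff)
  then show ?thesis using assms
    by (intro runs_1I) (simp add: cmd_step_def act_def read_tape_def work_tape_nth)
qed

lemma runs_Write_end:
  "runs x (Write f) (h, ps, length ps, out) 1 (h, ps @ [min 31 (f 0)], length ps, out)"
proof -
  have "work_tape (ps @ [v]) = (work_tape ps)(int (length ps) := v)" for v
    by (auto simp: work_tape_def fun_eq_iff nth_append)
  moreover have "work_tape ps (int (length ps)) = 0"
    by (simp add: work_tape_def)
  ultimately show ?thesis
    by (intro runs_1I) (simp add: cmd_step_def act_def read_tape_def)
qed

text \<open>Covers a mark that falls on the blank behind the list, as happens for an index out of
  range: the tape stays as it is.\<close>

lemma runs_Write_blank: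
  assumes "f 0 = 0"
  shows "runs x (Write f) (h, ps, length ps, out) 1 (h, ps, length ps, out)"
proof -
  have "work_tape ps (int (length ps)) = 0"
    by (simp add: work_tape_def)
  then show ?thesis using assms
    by (intro runs_1I) (simp add: cmd_step_def act_def read_tape_def fun_upd_idem)
qed

fun sym_in :: "bool list \<Rightarrow> store \<Rightarrow> nat" where
  "sym_in x (h, ps, k, out) = contents x (int h)"

fun sym_work :: "store \<Rightarrow> nat" where
  "sym_work (h, ps, k, out) = work_tape ps (int k)"

lemma map2_act_keep: "map2 act (keep (map read_tape ts)) ts = ts"
  by (induction ts) (auto simp: keep_def act_stay)

lemma reads: "map read_tape (tapes x s) ! 0 = sym_in x s" "map read_tape (tapes x s) ! Suc 0 = sym_work s"
  by (cases s; simp add: read_tape_def)+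

lemma runs_Seq:
  assumes "runs x c s T s'" "runs x d s' T' s''"
  shows "runs x (Seq c d) s (Suc (T + T')) s''"
proof -
  obtain n where n: "n \<le> T" "\<And>K. (cmd_step ^^ n) (c # K, tapes x s) = (K, tapes x s')"
    using assms(1) unfolding runs_def by blast
  obtain m where m: "m \<le> T'" "\<And>K. (cmd_step ^^ m) (d # K, tapes x s') = (K, tapes x s'')"
    using assms(2) unfolding runs_def by blast
  have "cmd_step (Seq c d # K, tapes x s) = (c # d # K, tapes x s)" for K
    by (simp add: cmd_step_def map2_act_keep)
  then have "(cmd_step ^^ (m + n + 1)) (Seq c d # K, tapes x s) = (K, tapes x s'')" for K
    using n(2)[of "d # K"] m(2)[of K]
    by (simp add: funpow_add funpow_swap1)
  then show ?thesis using n(1) m(1) unfolding runs_def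
    by (intro exI[of _ "m + n + 1"]) auto
qed

lemma runs_Cond_True:
  assumes "p (sym_in x s) (sym_work s)" "runs x c s T s'"
  shows "runs x (Cond p c d) s (Suc T) s'"
  by (rule runs_prefix[OF _ assms(2)]) (simp add: cmd_step_def reads assms(1) map2_act_keep)

lemma runs_Cond_False:
  assumes "\<not> p (sym_in x s) (sym_work s)" "runs x d s T s'"
  shows "runs x (Cond p c d) s (Suc T) s'"
  by (rule runs_prefix[OF _ assms(2)]) (simp add: cmd_step_def reads assms(1) map2_act_keep)

lemma runs_Loop_stop:
  assumes "\<not> p (sym_in x s) (sym_work s)"
  shows "runs x (Loop p c) s 1 s"
  by (rule runs_1I) (simp add: cmd_step_def reads assms(1) map2_act_keep)

lemma runs_Loop_step:
  assumes "p (sym_in x s) (sym_work s)" "runs x c s T s'" "runs x (Loop p c) s' T' s''"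
  shows "runs x (Loop p c) s (Suc (T + T')) s''"
proof -
  obtain n where n: "n \<le> T" "\<And>K. (cmd_step ^^ n) (c # K, tapes x s) = (K, tapes x s')"
    using assms(2) unfolding runs_def by blast
  obtain m where m: "m \<le> T'" "\<And>K. (cmd_step ^^ m) (Loop p c # K, tapes x s') = (K, tapes x s'')"
    using assms(3) unfolding runs_def by blast
  have "cmd_step (Loop p c # K, tapes x s) = (c # Loop p c # K, tapes x s)" for K
    by (simp add: cmd_step_def reads assms(1) map2_act_keep)
  then have "(cmd_step ^^ (m + n + 1)) (Loop p c # K, tapes x s) = (K, tapes x s'')" for K
    using n(2)[of "Loop p c # K"] m(2)[of K]
    by (simp add: funpow_add funpow_swap1)
  then show ?thesis using n(1) m(1) unfolding runs_def
    by (intro exI[of _ "m + n + 1"]) auto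
qed

text \<open>The sequence \<open>s\<close> plays the role of an invariant: it names the store after
  \<open>i\<close> rounds. Every round costs its body and one test, and the failing test at the end
  one more step.\<close>

lemma runs_Loop:
  fixes s :: "nat \<Rightarrow> store"
  assumes "\<And>i. i < m \<Longrightarrow> p (sym_in x (s i)) (sym_work (s i)) \<and> runs x c (s i) T (s (Suc i))"
    and "\<not> p (sym_in x (s m)) (sym_work (s m))"
  shows "runs x (Loop p c) (s 0) (Suc (m * Suc T)) (s m)"
  using assms
proof (induction m arbitrary: s)
  case 0
  then show ?case using runs_Loop_stop by simp
next
  case (Suc m)
  have "runs x (Loop p c) (s (Suc 0)) (Suc (m * Suc T)) (s (Suc m))"
    using Suc.prems by (intro Suc.IH[of "\<lambda>i. s (Suc i)"]) auto
  then have "runs x (Loop p c) (s 0) (Suc (T + Suc (m * Suc T))) (s (Suc m))"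
    using Suc.prems(1)[of 0] by (blast intro: runs_Loop_step)
  then show ?case by (simp add: algebra_simps)
qed

section \<open>The rows of the matrix\<close>

text \<open>
  The work tape holds one cell for each symbol of the prefix \<open>1^a 0 1^e 0\<close> of the encoded
  formula, preceded by the end marker \<open>30\<close>. The symbols \<open>2\<close>, \<open>1\<close> and \<open>3\<close> stand for a universal
  variable, a separator and an existential variable, and a cell marked with the code \<open>c\<close> carries
  \<open>3 * c\<close> in addition. Each cell, separators included, contributes four columns: a triple and a
  decider. A row is described by the block of four entries that each cell symbol yields; box rows
  and link rows use the code \<open>1\<close> for the cell in question, and constraint rows the codes of
  the three literals.
\<close>

definition even_signs :: "rat list list" where
  "even_signs = [[1, 1, 1], [1, -1, -1], [-1, 1, -1], [-1, -1, 1]]"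

definition zero_block :: "rat list" where
  "zero_block = [0, 0, 0, 0]"

definition unmark :: "nat \<Rightarrow> nat" where
  "unmark s = (if s = 0 \<or> s = 30 then s else (s - 1) mod 3 + 1)"

text \<open>Codes enter as multiples of 3, so the residue modulo 3 always tells the kind of the
  cell. The codes in use are at most 6, which keeps marked symbols at most 21, below the end marker
  30.\<close>

definition mark :: "nat \<Rightarrow> nat \<Rightarrow> nat" where
  "mark c s = (if s = 0 \<or> s = 30 then s else unmark s + 3 * c)"

definition box_block :: "nat \<Rightarrow> nat \<Rightarrow> rat list" where
  "box_block c s = (if 3 < s then zero_block[c := if c = 3 then 8 else 4] else zero_block)"

text \<open>Symbol 5 is a universal cell with code 1, so the link row of any other cell vanishes.
  The opposite signs of the weights make parity and decider cancel when they agree and add up when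
  they disagree.\<close>

definition link_block :: "rat list \<Rightarrow> nat \<Rightarrow> rat list" where
  "link_block e s = (if s = 5 then map ((*) 2) e @ [-4] else zero_block)"

text \<open>Inverts \<open>literal_code\<close>: \<open>c\<close> is \<open>2 * k\<close> plus the
  sign bit. The \<open>mod 3\<close> keeps the index in range for symbols that no literal produces,
  so that all blocks have length 4.\<close>

definition clause_block :: "rat list list \<Rightarrow> nat \<Rightarrow> rat list" where
  "clause_block es s = (if s \<le> 3 then zero_block
     else let c = (s - 1) div 3 - 1
          in map ((*) (if odd c then 1 else -1)) (es ! (c div 2 mod 3)) @ [0])"

definition local_blocks :: "(nat \<Rightarrow> rat list) list" where
  "local_blocks = map box_block [0..<4] @ map link_block even_signs"

definition clause_blocks :: "(nat \<Rightarrow> rat list) list" where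
  "clause_blocks =
     [clause_block [e0, e1, e2]. e0 \<leftarrow> even_signs, e1 \<leftarrow> even_signs, e2 \<leftarrow> even_signs]"

definition block_row :: "(nat \<Rightarrow> rat list) \<Rightarrow> nat list \<Rightarrow> rat list" where
  "block_row g cs = concat (map g cs)"

definition local_rows :: "nat list \<Rightarrow> rat list list" where
  "local_rows cs = concat (map (\<lambda>p. map (\<lambda>g. block_row g (cs[p := mark 1 (cs ! p)])) local_blocks)
     [0..<length cs])"

definition cells :: "nat \<Rightarrow> nat \<Rightarrow> nat list" where
  "cells a e = replicate a 2 @ 1 # replicate e 3 @ [1]"

fun position :: "nat \<Rightarrow> var \<Rightarrow> nat" where
  "position a (Inl i) = i"
| "position a (Inr j) = Suc (a + j)"

definition literal_code :: "nat \<Rightarrow> bool \<Rightarrow> nat" where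
  "literal_code k b = 1 + 2 * k + (if b then 1 else 0)"

definition mark_literal :: "nat \<Rightarrow> nat \<Rightarrow> literal \<Rightarrow> nat list \<Rightarrow> nat list" where
  "mark_literal a k l cs =
     cs[position a (fst l) := mark (literal_code k (snd l)) (cs ! position a (fst l))]"

definition marked :: "nat \<Rightarrow> nat \<Rightarrow> nae_constraint \<Rightarrow> nat list" where
  "marked a e C = mark_literal a 2 (C ! 2) (mark_literal a 1 (C ! 1) (mark_literal a 0 (C ! 0) (cells a e)))"

definition clause_rows :: "nat list \<Rightarrow> rat list list" where
  "clause_rows cs = map (\<lambda>g. block_row g cs) clause_blocks"

definition formula_rows :: "nae_formula \<Rightarrow> rat list list" where
  "formula_rows \<phi> = local_rows (cells (num_univ \<phi>) (num_exis \<phi>)) @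
     concat (map (\<lambda>C. clause_rows (marked (num_univ \<phi>) (num_exis \<phi>) C)) (constraints \<phi>))"

lemma length_even_signs: "e \<in> set even_signs \<Longrightarrow> length e = 3"
  by (auto simp: even_signs_def)

lemma length_zero_block [simp]: "length zero_block = 4"
  by (simp add: zero_block_def)

lemma length_local_block: "g \<in> set local_blocks \<Longrightarrow> length (g s) = 4"
  by (auto simp: local_blocks_def box_block_def link_block_def length_even_signs)

lemma clause_blocks_iff:
  "g \<in> set clause_blocks \<longleftrightarrow> (\<exists>e0\<in>set even_signs. \<exists>e1\<in>set even_signs. \<exists>e2\<in>set even_signs.
     g = clause_block [e0, e1, e2])"
  by (auto simp: clause_blocks_def)

lemma length_clause_block: "g \<in> set clause_blocks \<Longrightarrow> length (g s) = 4"
proof -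
  assume "g \<in> set clause_blocks"
  then obtain e0 e1 e2 where e: "e0 \<in> set even_signs" "e1 \<in> set even_signs" "e2 \<in> set even_signs"
    and g: "g = clause_block [e0, e1, e2]" unfolding clause_blocks_iff by blast
  have "length ([e0, e1, e2] ! (n mod 3)) = 3" for n
  proof -
    have "n mod 3 = 0 \<or> n mod 3 = 1 \<or> n mod 3 = 2" by linarith
    then show ?thesis using e by (auto simp: length_even_signs)
  qed
  then show ?thesis by (auto simp: g clause_block_def Let_def)
qed

lemma length_block_row: "(\<And>s. length (g s) = 4) \<Longrightarrow> length (block_row g cs) = 4 * length cs"
  by (induction cs) (auto simp: block_row_def)

lemma sum_4: "(\<Sum>c<(4::nat). f c) = f 0 + f 1 + f 2 + (f 3 :: real)"
  by (simp add: numeral_eq_Suc)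

lemma sum_lessThan_add: "(\<Sum>j<m + n. f j) = (\<Sum>j<m. f j) + (\<Sum>j<n. f (m + j) :: real)" for m n :: nat
  by (induction n) auto

lemma row_sum:
  assumes "\<And>s. length (g s) = 4"
  shows "(\<Sum>j<4 * length cs. of_rat (block_row g cs ! j) * y j) =
     (\<Sum>p<length cs. \<Sum>c<4. of_rat (g (cs ! p) ! c) * (y (4 * p + c) :: real))"
proof (induction cs arbitrary: y)
  case (Cons s cs)
  have "(\<Sum>j<4 * length (s # cs). of_rat (block_row g (s # cs) ! j) * y j) =
     (\<Sum>j<4 + 4 * length cs. of_rat ((g s @ block_row g cs) ! j) * y j)"
    by (simp add: block_row_def)
  also have "\<dots> = (\<Sum>c<4. of_rat (g s ! c) * y c) + (\<Sum>j<4 * length cs. of_rat (block_row g cs ! j) * y (4 + j))"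
    by (simp add: sum_lessThan_add nth_append assms)
  also have "\<dots> = (\<Sum>c<4. of_rat (g s ! c) * y c) + (\<Sum>p<length cs. \<Sum>c<4. of_rat (g (cs ! p) ! c) * y (4 + (4 * p + c)))"
    using Cons.IH[of "\<lambda>j. y (4 + j)"] by simp
  also have "\<dots> = (\<Sum>p<length (s # cs). \<Sum>c<4. of_rat (g ((s # cs) ! p) ! c) * y (4 * p + c))"
    by (simp add: sum.lessThan_Suc_shift algebra_simps del: sum.lessThan_Suc)
  finally show ?case .
qed (simp add: block_row_def)

definition signed_sum :: "rat list \<Rightarrow> nat \<Rightarrow> (nat \<Rightarrow> real) \<Rightarrow> real" where
  "signed_sum e p y = (\<Sum>c<3. of_rat (e ! c) * y (4 * p + c))"

lemma signed_sum_3: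
  "signed_sum e p y = of_rat (e ! 0) * y (4 * p) + of_rat (e ! 1) * y (4 * p + 1) + of_rat (e ! 2) * y (4 * p + 2)"
  by (simp add: signed_sum_def numeral_eq_Suc)

definition row_value :: "(nat \<Rightarrow> rat list) \<Rightarrow> nat list \<Rightarrow> (nat \<Rightarrow> real) \<Rightarrow> real" where
  "row_value g cs y = (\<Sum>j<4 * length cs. of_rat (block_row g cs ! j) * y j)"

lemma cells_length: "length (cells a e) = a + e + 2"
  by (simp add: cells_def)

lemma cells_set: "s \<in> set (cells a e) \<Longrightarrow> s \<in> {1, 2, 3}"
  by (auto simp: cells_def)

lemma cells_nth: "p < a + e + 2 \<Longrightarrow> cells a e ! p \<in> {1, 2, 3}"
  using cells_set[OF nth_mem] by (metis cells_length)

lemma cells_univ: "p < a + e + 2 \<Longrightarrow> cells a e ! p = 2 \<longleftrightarrow> p < a"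
  by (auto simp: cells_def nth_append nth_Cons split: nat.splits)

lemma row_value_single:
  assumes g: "\<And>s. length (g s) = 4" "\<And>s. s \<in> {1,2,3} \<Longrightarrow> g s = zero_block"
    and cs: "set cs \<subseteq> {1,2,3}" "p < length cs"
  shows "row_value g (cs[p := s]) y = (\<Sum>c<4. of_rat (g s ! c) * y (4 * p + c))"
proof -
  have z: "g (cs ! i) = zero_block" if "i < length cs" for i
    using g(2) cs(1) nth_mem[OF that] by blast
  have "row_value g (cs[p := s]) y =
      (\<Sum>i<length cs. \<Sum>c<4. of_rat (g (cs[p := s] ! i) ! c) * y (4 * i + c))"
    unfolding row_value_def using row_sum[of g "cs[p := s]" y] g(1) by simp
  also have "\<dots> = (\<Sum>i<length cs. if i = p then \<Sum>c<4. of_rat (g s ! c) * y (4 * p + c) else 0)"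
    by (intro sum.cong refl) (auto simp: nth_list_update z zero_block_def sum_4)
  also have "\<dots> = (\<Sum>c<4. of_rat (g s ! c) * y (4 * p + c))"
    using cs(2) by simp
  finally show ?thesis .
qed

section \<open>Rounding triples\<close>

text \<open>
  Rounding up two of the coordinates raises one of the four forms by \<open>2\<close>, lowers the one with three
  equal signs by \<open>2\<close> and leaves the others unchanged. If rounding down fails, it therefore suffices to raise
  the smallest of the forms with two minus signs: the four forms sum to \<open>0\<close>.
\<close>

lemma even_round:
  fixes w0 w1 w2 :: real
  assumes "0 \<le> w0" "w0 \<le> 1" "0 \<le> w1" "w1 \<le> 1" "0 \<le> w2" "w2 \<le> 1"
  shows "\<exists>x0\<in>{0,1}. \<exists>x1\<in>{0,1}. \<exists>x2\<in>{0,1}. \<forall>e\<in>set even_signs.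
    let t = of_rat (e ! 0) * (w0 - x0) + of_rat (e ! 1) * (w1 - x1) + of_rat (e ! 2) * (w2 - x2)
    in -1 \<le> t \<and> t \<le> 3/2"
    (is "\<exists>x0\<in>_. \<exists>x1\<in>_. \<exists>x2\<in>_. ?P x0 x1 x2")
proof -
  have P: "?P x0 x1 x2 \<longleftrightarrow>
      -1 \<le> (w0 - x0) + (w1 - x1) + (w2 - x2) \<and> (w0 - x0) + (w1 - x1) + (w2 - x2) \<le> 3/2 \<and>
      -1 \<le> (w0 - x0) - (w1 - x1) - (w2 - x2) \<and> (w0 - x0) - (w1 - x1) - (w2 - x2) \<le> 3/2 \<and>
      -1 \<le> - (w0 - x0) + (w1 - x1) - (w2 - x2) \<and> - (w0 - x0) + (w1 - x1) - (w2 - x2) \<le> 3/2 \<and>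
      -1 \<le> - (w0 - x0) - (w1 - x1) + (w2 - x2) \<and> - (w0 - x0) - (w1 - x1) + (w2 - x2) \<le> 3/2" for x0 x1 x2
    by (simp add: even_signs_def of_rat_minus algebra_simps)
  define m where "m = min (w0 - w1 - w2) (min (w1 - w0 - w2) (w2 - w0 - w1))"
  have "?P 0 0 0" if "w0 + w1 + w2 \<le> 3/2" "m \<ge> -1"
    unfolding P using that assms by (simp add: m_def)
  moreover have "?P 0 1 1" if "\<not> (w0 + w1 + w2 \<le> 3/2 \<and> m \<ge> -1)" "m = w0 - w1 - w2"
    unfolding P using that assms by (auto simp: m_def min_def split: if_splits)
  moreover have "?P 1 0 1" if "\<not> (w0 + w1 + w2 \<le> 3/2 \<and> m \<ge> -1)" "m = w1 - w0 - w2"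
    unfolding P using that assms by (auto simp: m_def min_def split: if_splits)
  moreover have "?P 1 1 0" if "\<not> (w0 + w1 + w2 \<le> 3/2 \<and> m \<ge> -1)" "m = w2 - w0 - w1"
    unfolding P using that assms by (auto simp: m_def min_def split: if_splits)
  moreover have "m = w0 - w1 - w2 \<or> m = w1 - w0 - w2 \<or> m = w2 - w0 - w1"
    by (auto simp: m_def min_def)
  moreover have "0 \<in> {0, 1 :: real}" "1 \<in> {0, 1 :: real}" by auto
  ultimately show ?thesis by meson
qed

abbreviation sgn_of :: "bool \<Rightarrow> real" where
  "sgn_of b \<equiv> if b then 1 else -1"

text \<open>For \<open>b\<close> false, \<open>even_round\<close> is applied to the reflected point
  \<open>1 - w\<close> and its rounding is reflected back:
  \<open>(1 - w) - x = -(w - (1 - x))\<close>.\<close>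

lemma parity_round:
  fixes w0 w1 w2 :: real
  assumes "0 \<le> w0" "w0 \<le> 1" "0 \<le> w1" "w1 \<le> 1" "0 \<le> w2" "w2 \<le> 1"
  shows "\<exists>x0\<in>{0,1}. \<exists>x1\<in>{0,1}. \<exists>x2\<in>{0,1}. \<forall>e\<in>set even_signs.
    let t = sgn_of b * (of_rat (e ! 0) * (w0 - x0) + of_rat (e ! 1) * (w1 - x1) + of_rat (e ! 2) * (w2 - x2))
    in -1 \<le> t \<and> t \<le> 3/2"
proof (cases b)
  case False
  have "\<exists>x0\<in>{0,1}. \<exists>x1\<in>{0,1}. \<exists>x2\<in>{0,1}. \<forall>e\<in>set even_signs.
    let t = of_rat (e ! 0) * ((1 - w0) - x0) + of_rat (e ! 1) * ((1 - w1) - x1) + of_rat (e ! 2) * ((1 - w2) - x2)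
    in -1 \<le> t \<and> t \<le> 3/2"
    by (rule even_round) (use assms in auto)
  then obtain x0 x1 x2 :: real where "x0 \<in> {0,1}" "x1 \<in> {0,1}" "x2 \<in> {0,1}"
    "\<forall>e\<in>set even_signs.
    let t = of_rat (e ! 0) * ((1 - w0) - x0) + of_rat (e ! 1) * ((1 - w1) - x1) + of_rat (e ! 2) * ((1 - w2) - x2)
    in -1 \<le> t \<and> t \<le> 3/2"
    by blast
  then show ?thesis using False
    by (intro bexI[of _ "1 - x0"] bexI[of _ "1 - x1"] bexI[of _ "1 - x2"])
       (auto simp: Let_def algebra_simps)
qed (use even_round[OF assms] in simp)

section \<open>Values of the rows\<close>

lemma mark_base: "s \<in> {1, 2, 3} \<Longrightarrow> mark c s = s + 3 * c"
  by (auto simp: mark_def unmark_def)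

lemma row_value_box:
  assumes "set cs \<subseteq> {1, 2, 3}" "p < length cs" "c < 4"
  shows "row_value (box_block c) (cs[p := mark 1 (cs ! p)]) y = (if c = 3 then 8 else 4) * y (4 * p + c)"
proof -
  have s: "cs ! p \<in> {1,2,3}" using assms nth_mem by blast
  have "row_value (box_block c) (cs[p := mark 1 (cs ! p)]) y =
      (\<Sum>i<4. of_rat (box_block c (mark 1 (cs ! p)) ! i) * y (4 * p + i))"
    by (rule row_value_single[OF _ _ assms(1,2)]) (auto simp: box_block_def)
  also have "box_block c (mark 1 (cs ! p)) = zero_block[c := if c = 3 then 8 else 4]"
    using s by (auto simp: box_block_def mark_base)
  also have "(\<Sum>i<4. of_rat (zero_block[c := if c = 3 then 8 else 4] ! i) * y (4 * p + i))
      = (if c = 3 then 8 else 4) * y (4 * p + c)"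
  proof -
    have "c = 0 \<or> c = 1 \<or> c = 2 \<or> c = 3" using assms(3) by linarith
    then show ?thesis by (elim disjE) (simp_all add: sum_4 zero_block_def numeral_eq_Suc of_rat_add)
  qed
  finally show ?thesis .
qed

lemma row_value_link:
  assumes "set cs \<subseteq> {1, 2, 3}" "p < length cs" "e \<in> set even_signs"
  shows "row_value (link_block e) (cs[p := mark 1 (cs ! p)]) y =
    (if cs ! p = 2 then 2 * signed_sum e p y - 4 * y (4 * p + 3) else 0)"
proof -
  have s: "cs ! p \<in> {1,2,3}" using assms nth_mem by blast
  have e: "length e = 3" using assms(3) by (rule length_even_signs)
  have "row_value (link_block e) (cs[p := mark 1 (cs ! p)]) y =
      (\<Sum>i<4. of_rat (link_block e (mark 1 (cs ! p)) ! i) * y (4 * p + i))"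
    by (rule row_value_single[OF _ _ assms(1,2)]) (auto simp: link_block_def e)
  also have "link_block e (mark 1 (cs ! p)) = (if cs ! p = 2 then map ((*) 2) e @ [-4] else zero_block)"
    using s by (auto simp: link_block_def mark_base)
  also have "(\<Sum>i<4. of_rat ((if cs ! p = 2 then map ((*) 2) e @ [-4] else zero_block) ! i) * y (4 * p + i))
      = (if cs ! p = 2 then 2 * signed_sum e p y - 4 * y (4 * p + 3) else 0)"
    using e by (simp add: sum_4 signed_sum_3 zero_block_def nth_append of_rat_mult of_rat_minus algebra_simps)
  finally show ?thesis .
qed

lemma position_less: "v \<in> {..<a} <+> {..<e} \<Longrightarrow> position a v < a + e + 2"
  by auto

lemma position_inj: "v \<in> {..<a} <+> {..<e} \<Longrightarrow> v' \<in> {..<a} <+> {..<e} \<Longrightarrow>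
    position a v = position a v' \<longleftrightarrow> v = v'"
  by (auto elim!: PlusE)

text \<open>Distinct variables have distinct cells, so no mark overwrites another; unmarked cells
  contribute zero blocks, and the row splits into one contribution per literal.\<close>

lemma row_value_clause:
  assumes C: "C = [l0, l1, l2]" "distinct (map fst C)" "fst ` set C \<subseteq> {..<a} <+> {..<e}"
    and es: "e0 \<in> set even_signs" "e1 \<in> set even_signs" "e2 \<in> set even_signs"
  shows "row_value (clause_block [e0, e1, e2]) (marked a e C) y =
    sgn_of (snd l0) * signed_sum e0 (position a (fst l0)) y +
    sgn_of (snd l1) * signed_sum e1 (position a (fst l1)) y +
    sgn_of (snd l2) * signed_sum e2 (position a (fst l2)) y"
proof -
  let ?g = "clause_block [e0, e1, e2]"
  define q0 q1 q2 where q: "q0 = position a (fst l0)" "q1 = position a (fst l1)" "q2 = position a (fst l2)"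
  define cs where "cs = cells a e"
  have len: "length cs = a + e + 2" by (simp add: cs_def cells_length)
  have ql: "q0 < length cs" "q1 < length cs" "q2 < length cs"
    using C by (auto simp: q len intro!: position_less)
  have qd: "q0 \<noteq> q1" "q0 \<noteq> q2" "q1 \<noteq> q2"
    using C by (auto simp: q position_inj)
  have base: "cs ! i \<in> {1, 2, 3}" if "i < length cs" for i
    using that cells_nth len by (simp add: cs_def)
  have lens: "length e0 = 3" "length e1 = 3" "length e2 = 3"
    using es by (auto simp: length_even_signs)
  define S where "S p s = (\<Sum>c<4. of_rat (?g s ! c) * y (4 * p + c))" for p s
  have M: "marked a e C = cs[q0 := mark (literal_code 0 (snd l0)) (cs ! q0),
      q1 := mark (literal_code 1 (snd l1)) (cs ! q1), q2 := mark (literal_code 2 (snd l2)) (cs ! q2)]"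
    using qd by (simp add: marked_def mark_literal_def C(1) cs_def[symmetric] q[symmetric])
  have "row_value ?g (marked a e C) y = (\<Sum>p<length cs. S p (marked a e C ! p))"
    unfolding row_value_def S_def
    using row_sum[of ?g "marked a e C" y] length_clause_block[of ?g] es
    by (simp add: M clause_blocks_iff) blast
  also have "\<dots> = (\<Sum>p<length cs. (if p = q0 then S q0 (mark (literal_code 0 (snd l0)) (cs ! q0)) else 0) +
      (if p = q1 then S q1 (mark (literal_code 1 (snd l1)) (cs ! q1)) else 0) +
      (if p = q2 then S q2 (mark (literal_code 2 (snd l2)) (cs ! q2)) else 0))"
  proof (intro sum.cong refl)
    fix p assume "p \<in> {..<length cs}"
    then have "S p (cs ! p) = 0"
      using base[of p] by (auto simp: S_def clause_block_def zero_block_def sum_4)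
    then show "S p (marked a e C ! p) = (if p = q0 then S q0 (mark (literal_code 0 (snd l0)) (cs ! q0)) else 0) +
      (if p = q1 then S q1 (mark (literal_code 1 (snd l1)) (cs ! q1)) else 0) +
      (if p = q2 then S q2 (mark (literal_code 2 (snd l2)) (cs ! q2)) else 0)"
      using qd ql by (auto simp: M nth_list_update)
  qed
  also have "\<dots> = S q0 (mark (literal_code 0 (snd l0)) (cs ! q0)) +
      S q1 (mark (literal_code 1 (snd l1)) (cs ! q1)) + S q2 (mark (literal_code 2 (snd l2)) (cs ! q2))"
    using ql by (simp add: sum.distrib)
  finally have total: "row_value ?g (marked a e C) y = S q0 (mark (literal_code 0 (snd l0)) (cs ! q0)) +
      S q1 (mark (literal_code 1 (snd l1)) (cs ! q1)) + S q2 (mark (literal_code 2 (snd l2)) (cs ! q2))" .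
  have S_lit: "S q (mark (literal_code k b) (cs ! q)) = sgn_of b * signed_sum ([e0, e1, e2] ! k) q y"
    if "q < length cs" "k < 3" for q k b
  proof -
    have k: "k = 0 \<or> k = 1 \<or> k = 2" using that by linarith
    have m: "mark (literal_code k b) (cs ! q) = cs ! q + 3 + 6 * k + (if b then 3 else 0)"
      using base[OF that(1)] by (auto simp: mark_base literal_code_def)
    \<comment> \<open>The base symbol minus 1 is at most 2 and disappears in the division by 3; the
      final \<open>- 1\<close> undoes the offset of \<open>literal_code\<close>.\<close>
    have d: "(cs ! q + 3 + 6 * k + (if b then 3 else 0) - 1) div 3 - 1 = 2 * k + (if b then 1 else 0)"
      using base[OF that(1)] k by auto
    have "?g (mark (literal_code k b) (cs ! q)) =
        map ((*) (if b then 1 else -1)) ([e0, e1, e2] ! k) @ [0]"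
      unfolding clause_block_def m d Let_def using base[OF that(1)] k by auto
    moreover have "length ([e0, e1, e2] ! k) = 3" using k lens by auto
    ultimately show ?thesis
      by (simp add: S_def sum_4 nth_append signed_sum_3 of_rat_mult of_rat_minus algebra_simps)
  qed
  from S_lit[OF ql(1), of 0] S_lit[OF ql(2), of 1] S_lit[OF ql(3), of 2]
  have "S q0 (mark (literal_code 0 (snd l0)) (cs ! q0)) = sgn_of (snd l0) * signed_sum e0 q0 y"
    "S q1 (mark (literal_code 1 (snd l1)) (cs ! q1)) = sgn_of (snd l1) * signed_sum e1 q1 y"
    "S q2 (mark (literal_code 2 (snd l2)) (cs ! q2)) = sgn_of (snd l2) * signed_sum e2 q2 y"
    by (simp_all del: of_nat_Suc)
  with total show ?thesis unfolding q by (simp only:)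
qed

section \<open>The linear forms that occur as rows\<close>

lemma local_row_in: "p < length cs \<Longrightarrow> g \<in> set local_blocks \<Longrightarrow>
    block_row g (cs[p := mark 1 (cs ! p)]) \<in> set (local_rows cs)"
  by (auto simp: local_rows_def)

definition columns :: "nae_formula \<Rightarrow> nat" where
  "columns \<phi> = 4 * (num_univ \<phi> + num_exis \<phi> + 2)"

lemma row_length: "r \<in> set (formula_rows \<phi>) \<Longrightarrow> length r = columns \<phi>"
  by (auto simp: formula_rows_def local_rows_def clause_rows_def columns_def marked_def mark_literal_def
      cells_length length_block_row length_local_block length_clause_block)

lemma length_3E:
  assumes "length C = 3" obtains l0 l1 l2 where "C = [l0, l1, l2]"
  using assms by (auto simp: numeral_3_eq_3 length_Suc_conv)

text \<open>Lists everything an upper bound on all rows has to check. Case \<open>zero\<close>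
  consists of the link rows of existential and separator cells.\<close>

lemma formula_row_cases:
  assumes "r \<in> set (formula_rows \<phi>)" "nae_e3_formula \<phi>"
  obtains
    (box) p c where "p < num_univ \<phi> + num_exis \<phi> + 2" "c < 4"
      "\<And>y :: nat \<Rightarrow> real. (\<Sum>j<columns \<phi>. of_rat (r ! j) * y j) = (if c = 3 then 8 else 4) * y (4 * p + c)"
  | (link) p e where "p < num_univ \<phi>" "e \<in> set even_signs"
      "\<And>y :: nat \<Rightarrow> real. (\<Sum>j<columns \<phi>. of_rat (r ! j) * y j) = 2 * signed_sum e p y - 4 * y (4 * p + 3)"
  | (zero) "\<And>y :: nat \<Rightarrow> real. (\<Sum>j<columns \<phi>. of_rat (r ! j) * y j) = 0"
  | (clause) l0 l1 l2 e0 e1 e2 where "[l0, l1, l2] \<in> set (constraints \<phi>)"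
      "e0 \<in> set even_signs" "e1 \<in> set even_signs" "e2 \<in> set even_signs"
      "\<And>y :: nat \<Rightarrow> real. (\<Sum>j<columns \<phi>. of_rat (r ! j) * y j) =
        sgn_of (snd l0) * signed_sum e0 (position (num_univ \<phi>) (fst l0)) y +
        sgn_of (snd l1) * signed_sum e1 (position (num_univ \<phi>) (fst l1)) y +
        sgn_of (snd l2) * signed_sum e2 (position (num_univ \<phi>) (fst l2)) y"
proof -
  let ?a = "num_univ \<phi>" and ?e = "num_exis \<phi>"
  let ?cs = "cells ?a ?e"
  have cs: "set ?cs \<subseteq> {1, 2, 3}" using cells_set by blast
  have len: "4 * length ?cs = columns \<phi>" by (simp add: cells_length columns_def)
  consider p g where "p < length ?cs" "g \<in> set local_blocks" "r = block_row g (?cs[p := mark 1 (?cs ! p)])"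
    | C g where "C \<in> set (constraints \<phi>)" "g \<in> set clause_blocks" "r = block_row g (marked ?a ?e C)"
    using assms(1) by (auto simp: formula_rows_def local_rows_def clause_rows_def)
  then show thesis
  proof cases
    case 1
    then have rv: "(\<Sum>j<columns \<phi>. of_rat (r ! j) * y j) = row_value g (?cs[p := mark 1 (?cs ! p)]) y"
      for y :: "nat \<Rightarrow> real"
      by (simp add: row_value_def len)
    from 1(2) consider c where "c < 4" "g = box_block c" | e where "e \<in> set even_signs" "g = link_block e"
      by (auto simp: local_blocks_def)
    then show thesis
    proof cases
      case 1
      then show thesis using box[of p c] \<open>p < length ?cs\<close> rv row_value_box[OF cs]
        by (simp add: cells_length)
    next
      case 2
      show thesis
      proof (cases "?cs ! p = 2")
        case True
        then have "p < ?a" using cells_univ \<open>p < length ?cs\<close> by (simp add: cells_length)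
        then show thesis
          using 2(2) rv row_value_link[OF cs \<open>p < length ?cs\<close> 2(1)] True
          by (intro link[OF _ 2(1), of p]) auto
      next
        case False
        then show thesis
          using 2(2) rv row_value_link[OF cs \<open>p < length ?cs\<close> 2(1)] by (intro zero) auto
      qed
    qed
  next
    case 2
    have C: "length C = 3" "distinct (map fst C)" "fst ` set C \<subseteq> {..<?a} <+> {..<?e}"
      using assms(2) 2(1) by (auto simp: nae_e3_formula_def)
    obtain l0 l1 l2 where l: "C = [l0, l1, l2]" using C(1) by (rule length_3E)
    obtain e0 e1 e2 where e: "e0 \<in> set even_signs" "e1 \<in> set even_signs" "e2 \<in> set even_signs"
      "g = clause_block [e0, e1, e2]" using 2(2) by (auto simp: clause_blocks_iff)
    have "(\<Sum>j<columns \<phi>. of_rat (r ! j) * y j) = row_value g (marked ?a ?e C) y" for y :: "nat \<Rightarrow> real"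
      using 2(3) by (simp add: row_value_def len[symmetric] marked_def mark_literal_def)
    then show thesis
      using clause[of l0 l1 l2 e0 e1 e2] 2(1) e l row_value_clause[OF l C(2,3) e(1-3)] by metis
  qed
qed

text \<open>With the next two lemmas, the converse of the case distinction, for arguments that need
  a particular row to be present.\<close>

lemma box_row:
  assumes "p < num_univ \<phi> + num_exis \<phi> + 2" "c < 4"
  shows "\<exists>r\<in>set (formula_rows \<phi>). \<forall>y :: nat \<Rightarrow> real.
    (\<Sum>j<columns \<phi>. of_rat (r ! j) * y j) = (if c = 3 then 8 else 4) * y (4 * p + c)"
proof -
  let ?cs = "cells (num_univ \<phi>) (num_exis \<phi>)"
  have cs: "set ?cs \<subseteq> {1, 2, 3}" "4 * length ?cs = columns \<phi>" "p < length ?cs"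
    using cells_set assms by (auto simp: cells_length columns_def)
  have "box_block c \<in> set local_blocks" using assms(2) by (auto simp: local_blocks_def)
  then have mem: "block_row (box_block c) (?cs[p := mark 1 (?cs ! p)]) \<in> set (formula_rows \<phi>)"
    using local_row_in[OF cs(3)] by (simp add: formula_rows_def)
  show ?thesis
    using row_value_box[OF cs(1,3) assms(2)] assms cs
    by (intro bexI[OF _ mem]) (simp add: row_value_def)
qed

lemma link_row:
  assumes "p < num_univ \<phi>" "e \<in> set even_signs"
  shows "\<exists>r\<in>set (formula_rows \<phi>). \<forall>y :: nat \<Rightarrow> real.
    (\<Sum>j<columns \<phi>. of_rat (r ! j) * y j) = 2 * signed_sum e p y - 4 * y (4 * p + 3)"
proof -
  let ?cs = "cells (num_univ \<phi>) (num_exis \<phi>)"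
  have cs: "set ?cs \<subseteq> {1, 2, 3}" "4 * length ?cs = columns \<phi>" "p < length ?cs"
    using cells_set assms by (auto simp: cells_length columns_def)
  have "link_block e \<in> set local_blocks" using assms(2) by (auto simp: local_blocks_def)
  then have mem: "block_row (link_block e) (?cs[p := mark 1 (?cs ! p)]) \<in> set (formula_rows \<phi>)"
    using local_row_in[OF cs(3)] by (simp add: formula_rows_def)
  have "?cs ! p = 2" using cells_univ assms(1) by simp
  then show ?thesis
    using row_value_link[OF cs(1,3) assms(2)] assms cs
    by (intro bexI[OF _ mem]) (simp add: row_value_def)
qed

lemma clause_row:
  assumes "nae_e3_formula \<phi>" "[l0, l1, l2] \<in> set (constraints \<phi>)"
      "e0 \<in> set even_signs" "e1 \<in> set even_signs" "e2 \<in> set even_signs"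
  shows "\<exists>r\<in>set (formula_rows \<phi>). \<forall>y :: nat \<Rightarrow> real.
    (\<Sum>j<columns \<phi>. of_rat (r ! j) * y j) =
        sgn_of (snd l0) * signed_sum e0 (position (num_univ \<phi>) (fst l0)) y +
        sgn_of (snd l1) * signed_sum e1 (position (num_univ \<phi>) (fst l1)) y +
        sgn_of (snd l2) * signed_sum e2 (position (num_univ \<phi>) (fst l2)) y"
proof -
  let ?a = "num_univ \<phi>" and ?e = "num_exis \<phi>"
  let ?M = "marked ?a ?e [l0, l1, l2]"
  have C: "distinct (map fst [l0, l1, l2])" "fst ` set [l0, l1, l2] \<subseteq> {..<?a} <+> {..<?e}"
    using assms(1,2) unfolding nae_e3_formula_def by blast+
  have len: "4 * length ?M = columns \<phi>" by (simp add: cells_length columns_def marked_def mark_literal_def)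
  have "clause_block [e0, e1, e2] \<in> set clause_blocks"
    using assms(3-5) unfolding clause_blocks_iff by blast
  then have "block_row (clause_block [e0, e1, e2]) ?M \<in> set (clause_rows ?M)"
    by (simp add: clause_rows_def)
  then have "block_row (clause_block [e0, e1, e2]) ?M \<in> set (formula_rows \<phi>)"
    using assms(2) unfolding formula_rows_def set_append set_concat set_map by blast
  then show ?thesis
    using row_value_clause[OF refl C assms(3-5)] unfolding row_value_def len by blast
qed

section \<open>YES instances: every point can be rounded within 4\<close>

definition truth :: "nat \<Rightarrow> (nat \<Rightarrow> bool) \<Rightarrow> (nat \<Rightarrow> bool) \<Rightarrow> nat \<Rightarrow> bool" where
  "truth a \<psi>\<^sub>A \<psi>\<^sub>E p = (if p < a then \<psi>\<^sub>A p else \<psi>\<^sub>E (p - Suc a))"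

lemma truth_position:
  "v \<in> {..<a} <+> {..<e} \<Longrightarrow> truth a \<psi>\<^sub>A \<psi>\<^sub>E (position a v) = case_sum \<psi>\<^sub>A \<psi>\<^sub>E v"
  by (auto simp: truth_def)

lemma block_index:
  fixes p c :: nat
  assumes "c < 4"
  shows "(4 * p + c) div 4 = p" "(4 * p + c) mod 4 = c"
  using assms by simp_all

text \<open>The point \<open>w\<close> fixes a universal assignment through its deciders,
  \<open>forall_exists_sat\<close> answers with an existential one, and each triple is rounded with
  the parity of its truth value. The answer can be used because both parities are available at every
  \<open>w\<close>.\<close>

lemma small_values:
  fixes w :: "nat \<Rightarrow> real"
  assumes \<phi>: "nae_e3_formula \<phi>" "forall_exists_sat \<phi>" and w: "\<And>j. 0 \<le> w j \<and> w j \<le> 1"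
  shows "\<exists>x. (\<forall>j. x j \<in> {0, 1}) \<and>
    (\<forall>r\<in>set (formula_rows \<phi>). \<bar>\<Sum>j<columns \<phi>. of_rat (r ! j) * (w j - x j)\<bar> \<le> 4)"
proof -
  let ?a = "num_univ \<phi>" and ?e = "num_exis \<phi>"
  \<comment> \<open>A true variable is one whose decider is rounded down and leaves a nonnegative
    rest, so the rest carries the sign of the truth value.\<close>
  define \<psi>\<^sub>A where "\<psi>\<^sub>A i \<longleftrightarrow> w (4 * i + 3) \<le> 1/2" for i
  obtain \<psi>\<^sub>E where sat: "satisfies (case_sum \<psi>\<^sub>A \<psi>\<^sub>E) \<phi>"
    using \<phi>(2) unfolding forall_exists_sat_def by blast
  \<comment> \<open>Separators receive a value as well. It is arbitrary, since only box rows have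
    nonzero entries in their columns.\<close>
  let ?v = "truth ?a \<psi>\<^sub>A \<psi>\<^sub>E"
  define G where "G p x0 x1 x2 \<longleftrightarrow> x0 \<in> {0, 1} \<and> x1 \<in> {0, 1} \<and> x2 \<in> {0, 1 :: real} \<and> (\<forall>e\<in>set even_signs.
    let t = sgn_of (?v p) * (of_rat (e ! 0) * (w (4 * p) - x0) + of_rat (e ! 1) * (w (4 * p + 1) - x1)
      + of_rat (e ! 2) * (w (4 * p + 2) - x2)) in -1 \<le> t \<and> t \<le> 3/2)" for p x0 x1 x2
  have "\<exists>x0 x1 x2. G p x0 x1 x2" for p
    unfolding G_def
    using parity_round[of "w (4 * p)" "w (4 * p + 1)" "w (4 * p + 2)" "?v p"] w by blast
  then obtain X0 X1 X2 where G: "\<And>p. G p (X0 p) (X1 p) (X2 p)"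
    by metis
  have X: "\<And>p. X0 p \<in> {0, 1}" "\<And>p. X1 p \<in> {0, 1}" "\<And>p. X2 p \<in> {0, 1}"
    and XS: "\<And>p. \<forall>e\<in>set even_signs.
    let t = sgn_of (?v p) * (of_rat (e ! 0) * (w (4 * p) - X0 p) + of_rat (e ! 1) * (w (4 * p + 1) - X1 p)
      + of_rat (e ! 2) * (w (4 * p + 2) - X2 p)) in -1 \<le> t \<and> t \<le> 3/2"
    using G unfolding G_def by blast+
  define x where "x j = (if j mod 4 = 0 then X0 (j div 4) else if j mod 4 = 1 then X1 (j div 4)
    else if j mod 4 = 2 then X2 (j div 4) else if w j \<le> 1/2 then 0 else 1)" for j
  have x_at: "x (4 * p) = X0 p" "x (4 * p + 1) = X1 p" "x (4 * p + 2) = X2 p"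
    "x (4 * p + 3) = (if w (4 * p + 3) \<le> 1/2 then 0 else 1)" for p
    using block_index[of 0 p] block_index[of 1 p] block_index[of 2 p] block_index[of 3 p]
    unfolding x_def by simp_all
  have x_bin: "x j \<in> {0, 1}" for j
    using X unfolding x_def by simp
  define y where "y j = w j - x j" for j
  have S: "-1 \<le> sgn_of (?v p) * signed_sum e p y \<and> sgn_of (?v p) * signed_sum e p y \<le> 3/2"
    if "e \<in> set even_signs" for e p
    using XS[of p] that unfolding Let_def signed_sum_3 y_def x_at by blast
  have D: "0 \<le> sgn_of (\<psi>\<^sub>A p) * y (4 * p + 3) \<and> sgn_of (\<psi>\<^sub>A p) * y (4 * p + 3) \<le> 1/2" for p
    using w[of "4 * p + 3"] by (auto simp: y_def x_at \<psi>\<^sub>A_def)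
  have y1: "\<bar>y j\<bar> \<le> 1" for j
    using w[of j] x_bin[of j] by (auto simp: y_def)
  have "\<bar>\<Sum>j<columns \<phi>. of_rat (r ! j) * y j\<bar> \<le> 4" if "r \<in> set (formula_rows \<phi>)" for r
    using that \<phi>(1)
  proof (cases rule: formula_row_cases)
    case (box p c)
    then show ?thesis using D[of p] y1[of "4 * p + c"] by (auto simp: abs_mult split: if_splits)
  next
    case (link p e)
    then have "?v p = \<psi>\<^sub>A p" by (simp add: truth_def)
    \<comment> \<open>Multiplied by the sign of the truth value, the row lies between
      \<open>2 * (-1) - 4 * (1/2) = -4\<close> and \<open>2 * (3/2) = 3\<close>.\<close>
    then show ?thesis using S[OF link(2), of p] D[of p] link(3)[of y] by (auto split: if_splits)
  next
    case (clause l0 l1 l2 e0 e1 e2)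
    let ?t = "\<lambda>l e. sgn_of (snd l) * signed_sum e (position ?a (fst l)) y"
    have vars: "fst l \<in> {..<?a} <+> {..<?e}" if "l \<in> {l0, l1, l2}" for l
      using \<phi>(1) clause(1) that unfolding nae_e3_formula_def by fastforce
    have lit: "(if eval_literal (case_sum \<psi>\<^sub>A \<psi>\<^sub>E) l then -1 \<le> ?t l e \<and> ?t l e \<le> 3/2
        else -3/2 \<le> ?t l e \<and> ?t l e \<le> 1)"
      if "l \<in> {l0, l1, l2}" "e \<in> set even_signs" for l e
      using S[OF that(2), of "position ?a (fst l)"] truth_position[OF vars[OF that(1)], of \<psi>\<^sub>A \<psi>\<^sub>E]
      by (auto simp: eval_literal_def split: if_splits)
    have "\<not> (\<exists>b. \<forall>l\<in>{l0, l1, l2}. eval_literal (case_sum \<psi>\<^sub>A \<psi>\<^sub>E) l = b)"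
      using sat clause(1) unfolding satisfies_def by fastforce
    then show ?thesis unfolding clause(5)
      using lit[of l0 e0] lit[of l1 e1] lit[of l2 e2] clause(2-4) by (auto split: if_splits)
  qed simp
  then show ?thesis using x_bin unfolding y_def by blast
qed

section \<open>NO instances: a point that no integer vector approximates\<close>

lemma half_signs:
  fixes a b c :: real
  assumes "a \<in> {1/2, -1/2}" "b \<in> {1/2, -1/2}" "c \<in> {1/2, -1/2}"
  shows "\<exists>e\<in>set even_signs. of_rat (e ! 0) * a + of_rat (e ! 1) * b + of_rat (e ! 2) * c =
    3/2 * sgn_of (0 < a * b * c)"
  \<comment> \<open>The witness is the sign pattern of \<open>(a, b, c)\<close> if the product is
    positive and its negative otherwise; either way it has an even number of minus signs.\<close>
  using assms unfolding insert_iff empty_iff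
  by (elim disjE FalseE; hypsubst; simp add: even_signs_def of_rat_minus)

text \<open>The upper bound is sharp, as \<open>8 * 9/16 = 9/2\<close>. Any target c with 3/8 <= c
  <= 7/16 would serve in the construction: 8 * (1 - c) >= 9/2 forces the decider and 3 + 4 * c >=
  9/2 the parity.\<close>

lemma near_7_16:
  fixes z :: real
  assumes "\<bar>8 * (7/16 - z)\<bar> < 9/2"
  shows "-1 < z" "z < 1"
  using assms by (simp_all add: abs_less_iff field_simps)

text \<open>The target 9/16 is the mirror image of 7/16, so a false universal variable reduces to a
  true one with \<open>1 - k\<close> for \<open>k\<close>.\<close>

lemma decider_near:
  assumes "\<bar>8 * ((if P then 7/16 else 9/16) - real_of_int k)\<bar> < 9/2"
  shows "k = (if P then 0 else 1)"
proof (cases P)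
  case True
  then have "\<bar>8 * (7/16 - real_of_int k)\<bar> < 9/2" using assms by (simp only: if_True)
  from near_7_16[OF this] have "k = 0" by simp
  then show ?thesis using True by simp
next
  case False
  have "8 * (7/16 - real_of_int (1 - k)) = - (8 * (9/16 - real_of_int k))"
    unfolding of_int_diff of_int_1 by (simp add: algebra_simps)
  then have "\<bar>8 * (7/16 - real_of_int (1 - k))\<bar> < 9/2"
    using assms False by (simp only: if_False abs_minus_cancel)
  from near_7_16[OF this] have "1 - k = 0" by linarith
  then show ?thesis using False by simp
qed
text \<open>The critical point depends only on a universal assignment without an answer. An integer
  \<open>x\<close> that keeps all rows below 9/2 would be forced to encode this assignment together
  with some existential one, and the violated constraint then has a row of absolute value
  9/2.\<close>

lemma large_value:
  assumes \<phi>: "nae_e3_formula \<phi>" "\<not> forall_exists_sat \<phi>"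
  shows "\<exists>w :: nat \<Rightarrow> real. (\<forall>j. 0 \<le> w j \<and> w j \<le> 1) \<and> (\<forall>x. (\<forall>j. x j \<in> \<int>) \<longrightarrow>
    (\<exists>r\<in>set (formula_rows \<phi>). 9/2 \<le> \<bar>\<Sum>j<columns \<phi>. of_rat (r ! j) * (w j - x j)\<bar>))"
proof -
  let ?a = "num_univ \<phi>" and ?e = "num_exis \<phi>"
  obtain \<psi>\<^sub>A where unsat: "\<And>\<psi>\<^sub>E. \<not> satisfies (case_sum \<psi>\<^sub>A \<psi>\<^sub>E) \<phi>"
    using \<phi>(2) unfolding forall_exists_sat_def by blast
  \<comment> \<open>Rounding a decider the wrong way costs \<open>8 * 9/16 = 9/2\<close> in its box row, and a triple of the
    wrong parity costs \<open>2 * 3/2 + 4 * 7/16 > 9/2\<close> in a link row.\<close>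
  define w :: "nat \<Rightarrow> real" where
    "w j = (if j mod 4 = 3 then (if \<psi>\<^sub>A (j div 4) then 7/16 else 9/16) else 1/2)" for j
  have w_at: "w (4 * p + 3) = (if \<psi>\<^sub>A p then 7/16 else 9/16)" "c < 3 \<Longrightarrow> w (4 * p + c) = 1/2" for p c
    using block_index[of 3 p] block_index[of c p] unfolding w_def by simp_all
  have "\<exists>r\<in>set (formula_rows \<phi>). 9/2 \<le> \<bar>\<Sum>j<columns \<phi>. of_rat (r ! j) * (w j - x j)\<bar>"
    if int: "\<forall>j. x j \<in> \<int>" for x
  proof (rule ccontr)
    assume neg: "\<not> ?thesis"
    define y where "y j = w j - x j" for j
    have small: "\<bar>\<Sum>j<columns \<phi>. of_rat (r ! j) * y j\<bar> < 9/2" if "r \<in> set (formula_rows \<phi>)" for r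
      using neg that unfolding y_def by force
    have box: "\<bar>(if c = 3 then 8 else 4) * y (4 * p + c)\<bar> < 9/2" if "p < ?a + ?e + 2" "c < 4" for p c
      using box_row[OF that] small by (metis (no_types, lifting))
    \<comment> \<open>Box rows alone leave two candidates per triple column: any other integer is at
      distance at least 3/2 from 1/2, and \<open>4 * 3/2 = 6\<close> exceeds 9/2.\<close>
    have halves: "y (4 * p + c) \<in> {1/2, -1/2}" if "p < ?a + ?e + 2" "c < 3" for p c
    proof -
      obtain k where k: "x (4 * p + c) = of_int k" using int by (meson Ints_cases)
      have "\<bar>4 * (1/2 - real_of_int k)\<bar> < 9/2"
        using box[OF that(1), of c] that(2) by (simp add: y_def w_at k)
      then have "real_of_int (\<bar>2 - 4 * k\<bar> * 2) < real_of_int 9" by simp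
      then have "\<bar>2 - 4 * k\<bar> * 2 < 9" by (simp only: of_int_less_iff)
      then have "k = 0 \<or> k = 1" by arith
      then show ?thesis using that(2) by (auto simp: y_def w_at k)
    qed
    have decider: "y (4 * p + 3) = (if \<psi>\<^sub>A p then 7/16 else -7/16)" if "p < ?a + ?e + 2" for p
    proof -
      obtain k where k: "x (4 * p + 3) = of_int k" using int by (meson Ints_cases)
      have "\<bar>8 * (w (4 * p + 3) - real_of_int k)\<bar> < 9/2"
        using box[OF that(1), of 3] by (simp add: y_def k)
      then have "k = (if \<psi>\<^sub>A p then 0 else 1)"
        unfolding w_at by (rule decider_near)
      then show ?thesis by (auto simp: y_def w_at k)
    qed
    define v where "v p \<longleftrightarrow> 0 < y (4 * p) * y (4 * p + 1) * y (4 * p + 2)" for p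
    have signs: "\<exists>e\<in>set even_signs. signed_sum e p y = 3/2 * sgn_of (v p)" if "p < ?a + ?e + 2" for p
      unfolding v_def signed_sum_3 using halves[OF that, of 0] halves[OF that, of 1] halves[OF that, of 2]
      by (intro half_signs) simp_all
    have univ: "v p = \<psi>\<^sub>A p" if p: "p < ?a" for p
    proof -
      obtain e where e: "e \<in> set even_signs" "signed_sum e p y = 3/2 * sgn_of (v p)"
        using signs[OF trans_less_add1[OF trans_less_add1[OF p]]] by blast
      have "\<bar>2 * signed_sum e p y - 4 * y (4 * p + 3)\<bar> < 9/2"
        using link_row[OF that e(1)] small by (metis (no_types, lifting))
      then show ?thesis using decider[of p] that e(2) by (auto split: if_splits)
    qed
    \<comment> \<open>The existential assignment is read off from the parities that \<open>x\<close>
      happens to have; \<open>unsat\<close> applies to it whatever it is.\<close>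
    define \<psi>\<^sub>E where "\<psi>\<^sub>E j = v (Suc (?a + j))" for j
    have val: "v (position ?a u) = case_sum \<psi>\<^sub>A \<psi>\<^sub>E u" if "u \<in> {..<?a} <+> {..<?e}" for u
      using that univ by (auto simp: \<psi>\<^sub>E_def)
    obtain C b where C: "C \<in> set (constraints \<phi>)" "\<forall>l\<in>set C. eval_literal (case_sum \<psi>\<^sub>A \<psi>\<^sub>E) l = b"
      using unsat[of \<psi>\<^sub>E] unfolding satisfies_def by blast
    have C3: "length C = 3" "fst ` set C \<subseteq> {..<?a} <+> {..<?e}"
      using \<phi>(1) C(1) unfolding nae_e3_formula_def by blast+
    obtain l0 l1 l2 where l: "C = [l0, l1, l2]" using C3(1) by (rule length_3E)
    have lit: "\<exists>e\<in>set even_signs. sgn_of (snd l) * signed_sum e (position ?a (fst l)) y = 3/2 * sgn_of b"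
      if "l \<in> set C" for l
    proof -
      have u: "fst l \<in> {..<?a} <+> {..<?e}" using C3(2) that by blast
      obtain e where e: "e \<in> set even_signs"
        "signed_sum e (position ?a (fst l)) y = 3/2 * sgn_of (v (position ?a (fst l)))"
        using signs[OF position_less[OF u]] by blast
      have "eval_literal (case_sum \<psi>\<^sub>A \<psi>\<^sub>E) l = b" using C(2) that by blast
      then have "v (position ?a (fst l)) = (if snd l then b else \<not> b)"
        unfolding eval_literal_def val[OF u, symmetric] by (auto split: if_splits)
      then have "sgn_of (snd l) * signed_sum e (position ?a (fst l)) y = 3/2 * sgn_of b"
        unfolding e(2) by (cases "snd l"; cases b) simp_all
      then show ?thesis using e(1) by blast
    qed
    have lC: "l0 \<in> set C" "l1 \<in> set C" "l2 \<in> set C" by (simp_all add: l)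
    obtain e0 where e0: "e0 \<in> set even_signs"
      "sgn_of (snd l0) * signed_sum e0 (position ?a (fst l0)) y = 3/2 * sgn_of b"
      using lit[OF lC(1)] by blast
    obtain e1 where e1: "e1 \<in> set even_signs"
      "sgn_of (snd l1) * signed_sum e1 (position ?a (fst l1)) y = 3/2 * sgn_of b"
      using lit[OF lC(2)] by blast
    obtain e2 where e2: "e2 \<in> set even_signs"
      "sgn_of (snd l2) * signed_sum e2 (position ?a (fst l2)) y = 3/2 * sgn_of b"
      using lit[OF lC(3)] by blast
    obtain r where r: "r \<in> set (formula_rows \<phi>)" "(\<Sum>j<columns \<phi>. of_rat (r ! j) * y j) =
        sgn_of (snd l0) * signed_sum e0 (position ?a (fst l0)) y +
        sgn_of (snd l1) * signed_sum e1 (position ?a (fst l1)) y +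
        sgn_of (snd l2) * signed_sum e2 (position ?a (fst l2)) y"
      using clause_row[OF \<phi>(1) C(1)[unfolded l] e0(1) e1(1) e2(1)] by blast
    \<comment> \<open>The left side is exactly 9/2, so the strictness of \<open>small\<close> yields
      the contradiction.\<close>
    have "\<bar>3/2 * sgn_of b + 3/2 * sgn_of b + 3/2 * sgn_of b\<bar> < 9/2"
      using small[OF r(1)] unfolding r(2) e0(2) e1(2) e2(2) .
    then show False by (cases b) simp_all
  qed
  moreover have "\<forall>j. 0 \<le> w j \<and> w j \<le> 1" by (auto simp: w_def)
  ultimately show ?thesis by blast
qed

section \<open>Linear discrepancy and covering radius\<close>

lemma linf_norm_le:
  assumes "0 \<le> c" "\<And>i. i < dim_vec v \<Longrightarrow> \<bar>v $ i\<bar> \<le> c"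
  shows "linf_norm v \<le> c"
  unfolding linf_norm_def using assms by (subst Max_le_iff) auto

lemma linf_norm_ge: "i < dim_vec v \<Longrightarrow> \<bar>v $ i\<bar> \<le> linf_norm v"
  unfolding linf_norm_def by (rule Max_ge) auto

lemma linf_norm_nonneg: "0 \<le> linf_norm v"
  unfolding linf_norm_def by (rule Max_ge) auto

lemma bdd_below_linf_norm: "bdd_below ((\<lambda>x. linf_norm (f x)) ` A)"
  by (rule bdd_belowI[of _ 0]) (auto simp: linf_norm_nonneg)

lemma lindisc_le:
  assumes "\<And>w. w \<in> unit_cube (dim_col B) \<Longrightarrow>
    \<exists>x\<in>binary_vecs (dim_col B). linf_norm (B *\<^sub>v (w - x)) \<le> c"
  shows "lindisc B \<le> c"
  unfolding lindisc_def
proof (rule cSUP_least)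
  have "0\<^sub>v (dim_col B) \<in> unit_cube (dim_col B)" by (simp add: unit_cube_def)
  then show "unit_cube (dim_col B) \<noteq> {}" by blast
next
  fix w assume "w \<in> unit_cube (dim_col B)"
  then obtain x where "x \<in> binary_vecs (dim_col B)" "linf_norm (B *\<^sub>v (w - x)) \<le> c"
    using assms by blast
  then show "(INF x \<in> binary_vecs (dim_col B). linf_norm (B *\<^sub>v (w - x))) \<le> c"
    by (intro cINF_lower2 bdd_below_linf_norm)
qed

text \<open>A lower bound through a real supremum requires boundedness: rounding every point of the
  cube to 0 bounds all values by the sum \<open>M\<close> of the absolute entries.\<close>

lemma covering_radius_ge:
  assumes "w \<in> unit_cube (dim_col B)"
    and "\<And>x. x \<in> int_vecs (dim_col B) \<Longrightarrow> c \<le> linf_norm (B *\<^sub>v (w - x))"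
  shows "c \<le> covering_radius B"
proof -
  let ?n = "dim_col B" and ?m = "dim_row B"
  let ?f = "\<lambda>w. INF x \<in> int_vecs ?n. linf_norm (B *\<^sub>v (w - x))"
  have zero: "0\<^sub>v ?n \<in> int_vecs ?n" by (simp add: int_vecs_def)
  define M where "M = (\<Sum>i<?m. \<Sum>j<?n. \<bar>B $$ (i, j)\<bar>)"
  have "?f v \<le> M" if v: "v \<in> unit_cube ?n" for v
  proof -
    have "linf_norm (B *\<^sub>v (v - 0\<^sub>v ?n)) \<le> M"
    proof (rule linf_norm_le)
      show "0 \<le> M" by (auto simp: M_def intro!: sum_nonneg)
      fix i assume "i < dim_vec (B *\<^sub>v (v - 0\<^sub>v ?n))"
      then have i: "i < ?m" by simp
      have vn: "v \<in> carrier_vec ?n" using v by (simp add: unit_cube_def)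
      then have "(B *\<^sub>v (v - 0\<^sub>v ?n)) $ i = (\<Sum>j<?n. B $$ (i, j) * v $ j)"
        using i by (auto simp: scalar_prod_def lessThan_atLeast0 intro!: sum.cong)
      also have "\<bar>\<dots>\<bar> \<le> (\<Sum>j<?n. \<bar>B $$ (i, j) * v $ j\<bar>)" by (rule sum_abs)
      also have "\<dots> \<le> (\<Sum>j<?n. \<bar>B $$ (i, j)\<bar>)"
        using v by (intro sum_mono) (auto simp: unit_cube_def abs_mult intro!: mult_left_le)
      also have "\<dots> \<le> M"
        unfolding M_def using i by (intro member_le_sum) (auto intro!: sum_nonneg)
      finally show "\<bar>(B *\<^sub>v (v - 0\<^sub>v ?n)) $ i\<bar> \<le> M" .
    qed
    then show ?thesis by (intro cINF_lower2[OF _ zero] bdd_below_linf_norm)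
  qed
  then have "bdd_above (?f ` unit_cube ?n)" by (auto intro!: bdd_aboveI)
  then have "?f w \<le> covering_radius B"
    unfolding covering_radius_def using assms(1) by (intro cSUP_upper)
  moreover have "c \<le> ?f w" using zero assms(2) by (intro cINF_greatest) auto
  ultimately show ?thesis by simp
qed

text \<open>Linear independence is stated for the set of columns, in which equal columns would
  collapse. Distinctness is therefore derived separately: two equal columns would put the difference
  of their unit vectors into the kernel.\<close>

lemma lattice_basisI:
  fixes B :: "real mat"
  assumes "0 < dim_col B"
    and inj: "\<And>v. v \<in> carrier_vec (dim_col B) \<Longrightarrow> B *\<^sub>v v = 0\<^sub>v (dim_row B) \<Longrightarrow> v = 0\<^sub>v (dim_col B)"
  shows "lattice_basis B"
proof -
  let ?n = "dim_col B" and ?m = "dim_row B"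
  interpret vec_space "TYPE(real)" ?m .
  have B: "B \<in> carrier_mat ?m ?n" by simp
  have dist: "distinct (cols B)"
  proof (unfold distinct_conv_nth, intro allI impI notI)
    fix i j assume ij: "i < length (cols B)" "j < length (cols B)" "i \<noteq> j" "cols B ! i = cols B ! j"
    define v :: "real vec" where "v = unit_vec ?n i - unit_vec ?n j"
    have "B *\<^sub>v v = 0\<^sub>v ?m"
    proof (rule eq_vecI)
      fix k assume "k < dim_vec (0\<^sub>v ?m :: real vec)"
      then have k: "k < ?m" by simp
      have "(B *\<^sub>v v) $ k = (\<Sum>l<?n. (if l = i then B $$ (k, l) else 0) - (if l = j then B $$ (k, l) else 0))"
        using k by (auto simp: v_def scalar_prod_def lessThan_atLeast0 unit_vec_def intro!: sum.cong)
      also have "\<dots> = B $$ (k, i) - B $$ (k, j)"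
        using ij by (simp add: sum_subtractf)
      also have "B $$ (k, i) = B $$ (k, j)"
        using arg_cong[OF ij(4), of "\<lambda>v. v $ k"] ij(1,2) k by simp
      finally show "(B *\<^sub>v v) $ k = 0\<^sub>v ?m $ k" using k by simp
    qed simp
    then have "v = 0\<^sub>v ?n" by (intro inj) (auto simp: v_def)
    then have "v $ i = 0" using ij by simp
    then show False using ij by (simp add: v_def)
  qed
  have "lin_indpt (set (cols B))"
    using lin_depE[OF B _ dist] inj by metis
  from lin_indpt_full_rank[OF B dist this] show ?thesis
    using assms(1) unfolding lattice_basis_def by simp
qed

section \<open>The matrix of a formula and its gap\<close>

definition crp_matrix :: "nae_formula \<Rightarrow> rat mat" where
  "crp_matrix \<phi> = mat_of_rows_list (columns \<phi>) (formula_rows \<phi>)"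

lemma crp_matrix_dim:
  "dim_row (crp_matrix \<phi>) = length (formula_rows \<phi>)" "dim_col (crp_matrix \<phi>) = columns \<phi>"
  by (simp_all add: crp_matrix_def mat_of_rows_list_def)

lemma crp_matrix_mult:
  fixes v :: "real vec"
  assumes "v \<in> carrier_vec (columns \<phi>)" "i < length (formula_rows \<phi>)"
  shows "(map_mat of_rat (crp_matrix \<phi>) *\<^sub>v v) $ i =
    (\<Sum>j<columns \<phi>. of_rat (formula_rows \<phi> ! i ! j) * v $ j)"
  using assms by (auto simp: crp_matrix_def mat_of_rows_list_def scalar_prod_def lessThan_atLeast0
      intro!: sum.cong)

lemma mat_to_list_crp_matrix: "mat_to_list (crp_matrix \<phi>) = formula_rows \<phi>"
proof -
  have "map ((!) r) [0..<columns \<phi>] = r" if "r \<in> set (formula_rows \<phi>)" for r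
    using row_length[OF that] map_nth[of r] by simp
  then show ?thesis
    by (intro nth_equalityI)
       (auto simp: mat_to_list_def crp_matrix_def mat_of_rows_list_def row_length[OF nth_mem])
qed

text \<open>Each column has a box row in which it alone has a nonzero entry, so a kernel vector
  vanishes coordinate by coordinate.\<close>

lemma crp_matrix_basis: "lattice_basis (map_mat real_of_rat (crp_matrix \<phi>))"
proof (rule lattice_basisI)
  show "0 < dim_col (map_mat real_of_rat (crp_matrix \<phi>))"
    by (simp add: crp_matrix_dim columns_def)
next
  fix v :: "real vec"
  assume v: "v \<in> carrier_vec (dim_col (map_mat real_of_rat (crp_matrix \<phi>)))"
    and zero: "map_mat of_rat (crp_matrix \<phi>) *\<^sub>v v = 0\<^sub>v (dim_row (map_mat real_of_rat (crp_matrix \<phi>)))"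
  have vc: "v \<in> carrier_vec (columns \<phi>)" using v by (simp add: crp_matrix_dim)
  have "v $ j = 0" if "j < columns \<phi>" for j
  proof -
    define p c where "p = j div 4" and "c = j mod 4"
    have j: "j = 4 * p + c" "c < 4" "p < num_univ \<phi> + num_exis \<phi> + 2"
      using that by (auto simp: p_def c_def columns_def)
    obtain r where "r \<in> set (formula_rows \<phi>)" and r: "(\<Sum>j<columns \<phi>. of_rat (r ! j) * v $ j) =
      (if c = 3 then 8 else 4) * v $ (4 * p + c)"
      using box_row[OF j(3,2)] by blast
    then obtain i where i: "i < length (formula_rows \<phi>)" "r = formula_rows \<phi> ! i"
      by (metis in_set_conv_nth)
    have "(map_mat of_rat (crp_matrix \<phi>) *\<^sub>v v) $ i = 0"
      using zero i by (simp add: crp_matrix_dim)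
    then show ?thesis using crp_matrix_mult[OF vc i(1)] r i(2) j(1) by (auto split: if_splits)
  qed
  then show "v = 0\<^sub>v (dim_col (map_mat real_of_rat (crp_matrix \<phi>)))"
    using vc by (intro eq_vecI) (auto simp: crp_matrix_dim)
qed

lemma lindisc_crp_matrix:
  assumes "nae_e3_formula \<phi>" "forall_exists_sat \<phi>"
  shows "lindisc (map_mat of_rat (crp_matrix \<phi>)) \<le> 4"
proof (rule lindisc_le)
  fix w :: "real vec" assume "w \<in> unit_cube (dim_col (map_mat real_of_rat (crp_matrix \<phi>)))"
  then have w: "w \<in> carrier_vec (columns \<phi>)" "\<And>j. j < columns \<phi> \<Longrightarrow> 0 \<le> w $ j \<and> w $ j \<le> 1"
    by (simp_all add: unit_cube_def crp_matrix_dim)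
  \<comment> \<open>\<open>small_values\<close> expects a total function into [0, 1]; beyond the
    last column the default 0 complies.\<close>
  define W where "W j = (if j < columns \<phi> then w $ j else 0)" for j
  have W: "0 \<le> W j \<and> W j \<le> 1" for j using w(2) by (simp add: W_def)
  obtain x where x: "\<And>j. x j \<in> {0, 1}"
    and small: "\<And>r. r \<in> set (formula_rows \<phi>) \<Longrightarrow> \<bar>\<Sum>j<columns \<phi>. of_rat (r ! j) * (W j - x j)\<bar> \<le> 4"
    using small_values[OF assms, of W, OF W] by blast
  define xv where "xv = vec (columns \<phi>) x"
  have "linf_norm (map_mat of_rat (crp_matrix \<phi>) *\<^sub>v (w - xv)) \<le> 4"
  proof (rule linf_norm_le)
    fix i assume "i < dim_vec (map_mat real_of_rat (crp_matrix \<phi>) *\<^sub>v (w - xv))"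
    then have i: "i < length (formula_rows \<phi>)" by (simp add: crp_matrix_dim)
    have "w - xv \<in> carrier_vec (columns \<phi>)" using w by (simp add: xv_def)
    from crp_matrix_mult[OF this i]
    have "(map_mat of_rat (crp_matrix \<phi>) *\<^sub>v (w - xv)) $ i =
        (\<Sum>j<columns \<phi>. of_rat (formula_rows \<phi> ! i ! j) * (W j - x j))"
      by (auto simp: xv_def W_def intro!: sum.cong)
    then show "\<bar>(map_mat of_rat (crp_matrix \<phi>) *\<^sub>v (w - xv)) $ i\<bar> \<le> 4"
      using small[OF nth_mem[OF i]] by simp
  qed simp
  moreover have "xv \<in> binary_vecs (columns \<phi>)" using x by (simp add: binary_vecs_def xv_def)
  ultimately show "\<exists>x\<in>binary_vecs (dim_col (map_mat real_of_rat (crp_matrix \<phi>))).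
      linf_norm (map_mat of_rat (crp_matrix \<phi>) *\<^sub>v (w - x)) \<le> 4"
    by (auto simp: crp_matrix_dim)
qed

lemma covering_radius_crp_matrix:
  assumes "nae_e3_formula \<phi>" "\<not> forall_exists_sat \<phi>"
  shows "9/2 \<le> covering_radius (map_mat of_rat (crp_matrix \<phi>))"
proof -
  obtain w :: "nat \<Rightarrow> real" where w: "\<And>j. 0 \<le> w j \<and> w j \<le> 1"
    and large: "\<And>x. \<forall>j. x j \<in> \<int> \<Longrightarrow>
      \<exists>r\<in>set (formula_rows \<phi>). 9/2 \<le> \<bar>\<Sum>j<columns \<phi>. of_rat (r ! j) * (w j - x j)\<bar>"
    using large_value[OF assms] by blast
  define wv where "wv = vec (columns \<phi>) w"
  show ?thesis
  proof (rule covering_radius_ge)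
    show "wv \<in> unit_cube (dim_col (map_mat real_of_rat (crp_matrix \<phi>)))"
      using w by (simp add: wv_def unit_cube_def crp_matrix_dim)
  next
    fix x :: "real vec" assume "x \<in> int_vecs (dim_col (map_mat real_of_rat (crp_matrix \<phi>)))"
    then have x: "x \<in> carrier_vec (columns \<phi>)" "\<And>j. j < columns \<phi> \<Longrightarrow> x $ j \<in> \<int>"
      by (simp_all add: int_vecs_def crp_matrix_dim)
    define X where "X j = (if j < columns \<phi> then x $ j else 0)" for j
    have "\<forall>j. X j \<in> \<int>" using x(2) by (simp add: X_def)
    then obtain r where "r \<in> set (formula_rows \<phi>)"
      and r: "9/2 \<le> \<bar>\<Sum>j<columns \<phi>. of_rat (r ! j) * (w j - X j)\<bar>"
      using large by blast
    then obtain i where i: "i < length (formula_rows \<phi>)" "r = formula_rows \<phi> ! i"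
      by (metis in_set_conv_nth)
    have "wv - x \<in> carrier_vec (columns \<phi>)" using x by (simp add: wv_def)
    from crp_matrix_mult[OF this i(1)]
    have "(map_mat of_rat (crp_matrix \<phi>) *\<^sub>v (wv - x)) $ i =
        (\<Sum>j<columns \<phi>. of_rat (formula_rows \<phi> ! i ! j) * (w j - X j))"
      using x(1) by (auto simp: wv_def X_def intro!: sum.cong)
    then have "9/2 \<le> \<bar>(map_mat of_rat (crp_matrix \<phi>) *\<^sub>v (wv - x)) $ i\<bar>"
      using r i(2) by simp
    also have "\<dots> \<le> linf_norm (map_mat of_rat (crp_matrix \<phi>) *\<^sub>v (wv - x))"
      using i by (intro linf_norm_ge) (simp add: crp_matrix_dim)
    finally show "9/2 \<le> linf_norm (map_mat of_rat (crp_matrix \<phi>) *\<^sub>v (wv - x))" .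
  qed
qed

text \<open>With radius 4 the NO threshold is \<open>9/2 - 4 * \<epsilon>\<close>, so a positive
  \<epsilon> turns the weak bound 9/2 on the covering radius into the strict inequality of the
  promise.\<close>

lemma reduction_correct:
  assumes "\<epsilon> > 0" and f: "\<And>\<phi>. nae_e3_formula \<phi> \<Longrightarrow> f (enc_formula \<phi>) = enc_crp (crp_matrix \<phi>, 4)"
    and "polytime f"
  shows "polytime_reducible forall_exists_nae_e3_sat (bin_gap_crp (9/8 - \<epsilon>))"
  unfolding polytime_reducible_def
proof (intro exI conjI ballI)
  show "polytime f" by fact
next
  fix x assume "x \<in> fst forall_exists_nae_e3_sat"
  then show "f x \<in> fst (bin_gap_crp (9/8 - \<epsilon>))"
    using f lindisc_crp_matrix crp_matrix_basis
    by (force simp: forall_exists_nae_e3_sat_def bin_gap_crp_def)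
next
  fix x assume "x \<in> snd forall_exists_nae_e3_sat"
  then obtain \<phi> where \<phi>: "x = enc_formula \<phi>" "nae_e3_formula \<phi>" "\<not> forall_exists_sat \<phi>"
    by (auto simp: forall_exists_nae_e3_sat_def)
  have "(9/8 - \<epsilon>) * of_rat 4 < covering_radius (map_mat of_rat (crp_matrix \<phi>))"
    using covering_radius_crp_matrix[OF \<phi>(2,3)] assms(1) by simp
  then show "f x \<in> snd (bin_gap_crp (9/8 - \<epsilon>))"
    using f \<phi> crp_matrix_basis by (force simp: bin_gap_crp_def)
qed

section \<open>The reduction as a loop program\<close>

definition Skip :: cmd where "Skip = Loop (\<lambda>_ _. False) Advance"

lemma runs_Skip: "runs x Skip s 1 s"
  unfolding Skip_def by (rule runs_Loop_stop) simp

primrec emit_word :: "bool list \<Rightarrow> cmd" where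
  "emit_word [] = Skip"
| "emit_word (b # bs) = Seq (Emit b) (emit_word bs)"

lemma runs_emit_word:
  "runs x (emit_word bs) (h, ps, k, out) (2 * length bs + 1) (h, ps, k, out @ bs)"
proof (induction bs arbitrary: out)
  case Nil
  then show ?case using runs_Skip by simp
next
  case (Cons b bs)
  show ?case
    using runs_Seq[OF runs_Emit[of x b] Cons.IH[of "out @ [b]"]] by simp
qed

text \<open>\<open>Emit\<close> writes a fixed bit, so output that depends on the symbol read is a
  case distinction over a finite list of symbols, hard-wired into the program.\<close>

primrec dispatch :: "(nat \<Rightarrow> bool list) \<Rightarrow> nat list \<Rightarrow> cmd" where
  "dispatch w [] = Skip"
| "dispatch w (v # vs) = Cond (\<lambda>_ s. s = v) (emit_word (w v)) (dispatch w vs)"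

lemma runs_dispatch:
  assumes "sym_work (h, ps, k, out) = v" "v \<in> set vs"
  shows "runs x (dispatch w vs) (h, ps, k, out) (length vs + 2 * length (w v) + 1) (h, ps, k, out @ w v)"
  using assms(2)
proof (induction vs)
  case (Cons u vs)
  show ?case
  proof (cases "u = v")
    case True
    have "runs x (dispatch w (u # vs)) (h, ps, k, out) (Suc (2 * length (w v) + 1)) (h, ps, k, out @ w v)"
      unfolding dispatch.simps True
      by (rule runs_Cond_True[OF _ runs_emit_word]) (use assms(1) in simp)
    then show ?thesis by (rule runs_weaken) simp
  next
    case False
    then have "runs x (dispatch w (u # vs)) (h, ps, k, out) (Suc (length vs + 2 * length (w v) + 1))
        (h, ps, k, out @ w v)"
      unfolding dispatch.simps by (intro runs_Cond_False) (use assms(1) Cons in simp_all)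
    then show ?thesis by (rule runs_weaken) simp
  qed
qed simp

text \<open>Excludes the blank 0 and the marker 30, so that the head recognises both ends of the
  list.\<close>

definition valid_cells :: "nat list \<Rightarrow> bool" where
  "valid_cells cs \<longleftrightarrow> set cs \<subseteq> {1..<30}"

lemma valid_cells_nth: "valid_cells cs \<Longrightarrow> i < length cs \<Longrightarrow> 0 < cs ! i \<and> cs ! i < 30"
  unfolding valid_cells_def using nth_mem by fastforce

lemma sym_work_Suc:
  "sym_work (h, 30 # cs, Suc i, out) = (if i < length cs then cs ! i else 0)"
  by (simp add: work_tape_def nat_add_distrib)

definition rewind :: cmd where
  "rewind = Loop (\<lambda>_ s. s \<noteq> 30) (Shift Lt)"

lemma runs_rewind:
  assumes "valid_cells cs"
  shows "runs x rewind (h, 30 # cs, k, out) (2 * k + 1) (h, 30 # cs, 0, out)"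
proof -
  let ?s = "\<lambda>i. (h, 30 # cs, k - i, out)"
  have "runs x rewind (?s 0) (Suc (k * Suc 1)) (?s k)"
    unfolding rewind_def
  proof (rule runs_Loop[where s = ?s])
    fix i assume i: "i < k"
    define j where "j = k - Suc i"
    have j: "k - i = Suc j" "k - Suc i = j" using i by (simp_all add: j_def)
    show "sym_work (?s i) \<noteq> 30 \<and> runs x (Shift Lt) (?s i) 1 (?s (Suc i))"
      unfolding j sym_work_Suc using valid_cells_nth[OF assms, of j] by (auto simp: runs_left[unfolded One_nat_def])
  qed (simp add: work_tape_def)
  then have "runs x rewind (h, 30 # cs, k, out) (Suc (k * Suc 1)) (h, 30 # cs, 0, out)"
    by (simp only: diff_zero diff_self_eq_0)
  then show ?thesis by (rule runs_weaken) simp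
qed

section \<open>Writing matrix rows from marked cells\<close>

definition alphabet :: "nat list" where "alphabet = [0..<32]"

lemma alphabet: "length alphabet = 32" "set alphabet = {..<32}"
  by (simp_all only: alphabet_def length_upt set_upt atLeast0LessThan)

definition block_code :: "(nat \<Rightarrow> rat list) \<Rightarrow> nat \<Rightarrow> bool list" where
  "block_code g s = concat (map (\<lambda>q. True # enc_rat q) (g s))"

text \<open>An \<open>enc_list\<close> without its closing \<open>False\<close>, hence additive
  under append: rows are emitted piecemeal and the terminator is written once at the end.\<close>

definition enc_rows :: "rat list list \<Rightarrow> bool list" where
  "enc_rows rs = concat (map (\<lambda>r. True # enc_list enc_rat r) rs)"

lemma enc_rows_simps [simp]:
  "enc_rows [] = []" "enc_rows (r # rs) = True # enc_list enc_rat r @ enc_rows rs"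
  "enc_rows (rs @ rs') = enc_rows rs @ enc_rows rs'"
  by (simp_all add: enc_rows_def)

lemma enc_list_block_row: "enc_list enc_rat (block_row g cs) = concat (map (block_code g) cs) @ [False]"
  by (induction cs) (simp_all add: enc_list_def block_row_def block_code_def)

definition emit_row :: "(nat \<Rightarrow> rat list) \<Rightarrow> cmd" where
  "emit_row g = Seq rewind (Seq (Shift Rt) (Seq (Emit True)
     (Seq (Loop (\<lambda>_ s. s \<noteq> 0) (Seq (dispatch (block_code g) alphabet) (Shift Rt))) (Emit False))))"

text \<open>The parameter \<open>n\<close> bounds the sizes of the tape contents, so that all running times can be
  stated as multiples of \<open>n\<close>.\<close>

lemma runs_emit_row:
  "\<exists>D. \<forall>x h cs k out n. valid_cells cs \<and> k \<le> Suc (length cs) \<and> length cs < n \<longrightarrow>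
    runs x (emit_row g) (h, 30 # cs, k, out) (D * n)
      (h, 30 # cs, Suc (length cs), out @ enc_rows [block_row g cs])"
proof -
  define W where "W = (\<Sum>s<32. length (block_code g s))"
  have W: "length (block_code g s) \<le> W" if "s < 32" for s
    unfolding W_def using that by (intro member_le_sum) auto
  have "runs x (emit_row g) (h, 30 # cs, k, out) ((60 + 2 * W) * n)
      (h, 30 # cs, Suc (length cs), out @ enc_rows [block_row g cs])"
    if cs: "valid_cells cs" and k: "k \<le> Suc (length cs)" and n: "length cs < n" for x h cs k out n
  proof -
    let ?s = "\<lambda>i. (h, 30 # cs, Suc i, (out @ [True]) @ concat (map (block_code g) (take i cs)))"
    let ?m = "length cs"
    have "runs x (Loop (\<lambda>_ s. s \<noteq> 0) (Seq (dispatch (block_code g) alphabet) (Shift Rt))) (?s 0)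
        (Suc (?m * Suc (Suc ((33 + 2 * W) + 1)))) (?s ?m)"
    proof (rule runs_Loop[where s = ?s])
      fix i assume i: "i < ?m"
      have c: "0 < cs ! i" "cs ! i < 30" using valid_cells_nth[OF cs i] by auto
      have "runs x (dispatch (block_code g) alphabet) (?s i) (length alphabet + 2 * length (block_code g (cs ! i)) + 1)
          (h, 30 # cs, Suc i, ((out @ [True]) @ concat (map (block_code g) (take i cs))) @ block_code g (cs ! i))"
        using c i by (intro runs_dispatch) (auto simp: alphabet(2) sym_work_Suc simp del: sym_work.simps)
      then have "runs x (dispatch (block_code g) alphabet) (?s i) (33 + 2 * W)
          (h, 30 # cs, Suc i, ((out @ [True]) @ concat (map (block_code g) (take i cs))) @ block_code g (cs ! i))"
        by (rule runs_weaken) (use W[of "cs ! i"] c in \<open>simp add: alphabet(1)\<close>)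
      from runs_Seq[OF this runs_right] i
      have "runs x (Seq (dispatch (block_code g) alphabet) (Shift Rt)) (?s i) (Suc ((33 + 2 * W) + 1)) (?s (Suc i))"
        by (simp add: take_Suc_conv_app_nth)
      then show "sym_work (?s i) \<noteq> 0 \<and>
          runs x (Seq (dispatch (block_code g) alphabet) (Shift Rt)) (?s i) (Suc ((33 + 2 * W) + 1)) (?s (Suc i))"
        using c i by (simp add: sym_work_Suc del: sym_work.simps)
    qed (simp add: sym_work_Suc del: sym_work.simps)
    then have loop: "runs x (Loop (\<lambda>_ s. s \<noteq> 0) (Seq (dispatch (block_code g) alphabet) (Shift Rt)))
        (h, 30 # cs, Suc 0, out @ [True]) (Suc (?m * Suc (Suc ((33 + 2 * W) + 1)))) (?s ?m)"
      by simp
    have fin: "(((out @ [True]) @ concat (map (block_code g) (take ?m cs))) @ [False]) = out @ enc_rows [block_row g cs]"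
      by (simp add: enc_list_block_row)
    have "runs x (emit_row g) (h, 30 # cs, k, out)
        (Suc ((2 * k + 1) + Suc (1 + Suc (1 + Suc (Suc (?m * Suc (Suc ((33 + 2 * W) + 1))) + 1)))))
        (h, 30 # cs, Suc ?m, out @ enc_rows [block_row g cs])"
      unfolding emit_row_def fin[symmetric]
      by (intro runs_Seq[OF runs_rewind[OF cs] runs_Seq[OF runs_right runs_Seq[OF runs_Emit runs_Seq[OF loop runs_Emit]]]])
    then show ?thesis
    proof (rule runs_weaken)
      have "Suc ((2 * k + 1) + Suc (1 + Suc (1 + Suc (Suc (?m * Suc (Suc ((33 + 2 * W) + 1))) + 1))))
        \<le> (60 + 2 * W) * Suc ?m" using k by (simp add: algebra_simps)
      also have "\<dots> \<le> (60 + 2 * W) * n" using n by (intro mult_le_mono) auto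
      finally show "Suc ((2 * k + 1) + Suc (1 + Suc (1 + Suc (Suc (?m * Suc (Suc ((33 + 2 * W) + 1))) + 1))))
        \<le> (60 + 2 * W) * n" .
    qed
  qed
  then show ?thesis by blast
qed

primrec emit_rows :: "(nat \<Rightarrow> rat list) list \<Rightarrow> cmd" where
  "emit_rows [] = rewind"
| "emit_rows (g # gs) = Seq (emit_row g) (emit_rows gs)"

lemma runs_emit_rows:
  "\<exists>D. \<forall>x h cs k out n. valid_cells cs \<and> k \<le> Suc (length cs) \<and> length cs < n \<longrightarrow>
    runs x (emit_rows gs) (h, 30 # cs, k, out) (D * n)
      (h, 30 # cs, 0, out @ enc_rows (map (\<lambda>g. block_row g cs) gs))"
proof (induction gs)
  case Nil
  have "runs x rewind (h, 30 # cs, k, out) (3 * n) (h, 30 # cs, 0, out)"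
    if "valid_cells cs" "k \<le> Suc (length cs)" "length cs < n" for x h cs k out n
    by (rule runs_weaken[OF runs_rewind[OF that(1)]]) (use that in simp)
  then show ?case by (simp only: emit_rows.simps list.map enc_rows_simps append_Nil2) blast
next
  case (Cons g gs)
  obtain D where D: "\<And>x h cs k out n. valid_cells cs \<Longrightarrow> k \<le> Suc (length cs) \<Longrightarrow> length cs < n \<Longrightarrow>
    runs x (emit_row g) (h, 30 # cs, k, out) (D * n)
      (h, 30 # cs, Suc (length cs), out @ enc_rows [block_row g cs])"
    using runs_emit_row[of g] by blast
  obtain D' where D': "\<And>x h cs k out n. valid_cells cs \<Longrightarrow> k \<le> Suc (length cs) \<Longrightarrow> length cs < n \<Longrightarrow>
    runs x (emit_rows gs) (h, 30 # cs, k, out) (D' * n)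
      (h, 30 # cs, 0, out @ enc_rows (map (\<lambda>g. block_row g cs) gs))"
    using Cons.IH by blast
  have "runs x (emit_rows (g # gs)) (h, 30 # cs, k, out) ((D + D' + 1) * n)
      (h, 30 # cs, 0, out @ enc_rows (map (\<lambda>g. block_row g cs) (g # gs)))"
    if "valid_cells cs" "k \<le> Suc (length cs)" "length cs < n" for x h cs k out n
  proof -
    have "runs x (emit_rows (g # gs)) (h, 30 # cs, k, out) (Suc (D * n + D' * n))
      (h, 30 # cs, 0, out @ enc_rows (map (\<lambda>g. block_row g cs) (g # gs)))"
      using runs_Seq[OF D[OF that] D'[OF that(1) le_refl that(3)]] by simp
    then show ?thesis by (rule runs_weaken) (use that in \<open>simp add: algebra_simps\<close>)
  qed
  then show ?case by blast
qed

definition base_cells :: "nat list \<Rightarrow> bool" where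
  "base_cells cs \<longleftrightarrow> set cs \<subseteq> {1, 2, 3}"

lemma base_cells_valid: "base_cells cs \<Longrightarrow> valid_cells cs"
  unfolding base_cells_def valid_cells_def by fastforce

lemma base_cells_nth: "base_cells cs \<Longrightarrow> i < length cs \<Longrightarrow> cs ! i = 1 \<or> cs ! i = 2 \<or> cs ! i = 3"
  unfolding base_cells_def using nth_mem by fastforce

lemma valid_cells_update: "valid_cells cs \<Longrightarrow> 0 < v \<Longrightarrow> v < 30 \<Longrightarrow> valid_cells (cs[i := v])"
  unfolding valid_cells_def using set_update_subset_insert[of cs i v] by auto

lemma unmark_range: "0 < s \<Longrightarrow> s < 30 \<Longrightarrow> 0 < unmark s \<and> unmark s \<le> 3"
  using mod_less_divisor[of 3 "s - 1"] by (simp add: unmark_def)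

lemma mark_range: "0 < s \<Longrightarrow> s < 30 \<Longrightarrow> c \<le> 6 \<Longrightarrow> 0 < mark c s \<and> mark c s < 30"
  using unmark_range[of s] by (simp add: mark_def)

lemma unmark_mark:
  assumes "0 < s" "s < 30" "c \<le> 6"
  shows "unmark (mark c s) = unmark s"
proof -
  define u where "u = unmark s"
  have u: "0 < u" "u \<le> 3" using unmark_range assms by (auto simp: u_def)
  have "(u + 3 * c - 1) mod 3 = ((u - 1) + 3 * c) mod 3" using u by simp
  also have "\<dots> = (u - 1) mod 3" by (rule mod_mult_self2)
  also have "\<dots> = u - 1" using u by (intro mod_less) simp
  finally show ?thesis
    using u assms by (simp add: mark_def u_def[symmetric] unmark_def[of "u + 3 * c"])
qed

text \<open>Emitting rows rewinds the head and loses the place. The mark serves as the bookmark: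
  among base cells it is the only symbol above 3 apart from the end marker, so the scan stops
  there.\<close>

definition local_body :: cmd where
  "local_body = Seq (Write (mark 1)) (Seq (emit_rows local_blocks)
     (Seq (Loop (\<lambda>_ s. s \<le> 3 \<or> s = 30) (Shift Rt)) (Seq (Write unmark) (Shift Rt))))"

lemma runs_Write_cell:
  assumes "i < length cs" "f (cs ! i) < 31"
  shows "runs x (Write f) (h, 30 # cs, Suc i, out) 1 (h, 30 # cs[i := f (cs ! i)], Suc i, out)"
  using runs_Write[of "Suc i" "30 # cs" x f h out] assms by (simp add: min_def split: if_splits)

lemma runs_local_body:
  "\<exists>D. \<forall>x h cs i out n. base_cells cs \<and> i < length cs \<and> length cs < n \<longrightarrow>
    runs x local_body (h, 30 # cs, Suc i, out) (D * n)
      (h, 30 # cs, Suc (Suc i), out @ enc_rows (map (\<lambda>g. block_row g (cs[i := mark 1 (cs ! i)])) local_blocks))"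
proof -
  obtain D where D: "\<And>x h cs k out n. valid_cells cs \<Longrightarrow> k \<le> Suc (length cs) \<Longrightarrow> length cs < n \<Longrightarrow>
    runs x (emit_rows local_blocks) (h, 30 # cs, k, out) (D * n)
      (h, 30 # cs, 0, out @ enc_rows (map (\<lambda>g. block_row g cs) local_blocks))"
    using runs_emit_rows[of local_blocks] by blast
  have "runs x local_body (h, 30 # cs, Suc i, out) ((D + 20) * n)
      (h, 30 # cs, Suc (Suc i), out @ enc_rows (map (\<lambda>g. block_row g (cs[i := mark 1 (cs ! i)])) local_blocks))"
    if cs: "base_cells cs" and i: "i < length cs" and n: "length cs < n" for x h cs i out n
  proof -
    define cs' where "cs' = cs[i := mark 1 (cs ! i)]"
    define out' where "out' = out @ enc_rows (map (\<lambda>g. block_row g cs') local_blocks)"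
    have c: "0 < cs ! i" "cs ! i < 30" using base_cells_nth[OF cs i] by auto
    have m: "mark 1 (cs ! i) = cs ! i + 3" "unmark (cs ! i + 3) = cs ! i"
      using base_cells_nth[OF cs i] by (auto simp: mark_def unmark_def)
    have v: "valid_cells cs'"
      unfolding cs'_def using base_cells_valid[OF cs] mark_range[OF c, of 1] by (intro valid_cells_update) auto
    have len: "length cs' = length cs" by (simp add: cs'_def)
    have w1: "runs x (Write (mark 1)) (h, 30 # cs, Suc i, out) 1 (h, 30 # cs', Suc i, out)"
      unfolding cs'_def using i m base_cells_nth[OF cs i] by (intro runs_Write_cell) auto
    have e: "runs x (emit_rows local_blocks) (h, 30 # cs', Suc i, out) (D * n) (h, 30 # cs', 0, out')"
      unfolding out'_def using D[OF v, of "Suc i" n] i n len by simp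
    let ?s = "\<lambda>j. (h, 30 # cs', j, out')"
    have "runs x (Loop (\<lambda>_ s. s \<le> 3 \<or> s = 30) (Shift Rt)) (?s 0) (Suc (Suc i * Suc 1)) (?s (Suc i))"
    proof (rule runs_Loop[where s = ?s])
      fix j assume "j < Suc i"
      then have "sym_work (?s j) \<le> 3 \<or> sym_work (?s j) = 30"
        using base_cells_nth[OF cs, of "j - 1"] i len
        by (cases j) (auto simp: sym_work_Suc work_tape_def cs'_def nat_add_distrib)
      then show "(sym_work (?s j) \<le> 3 \<or> sym_work (?s j) = 30) \<and> runs x (Shift Rt) (?s j) 1 (?s (Suc j))"
        using runs_right by blast
    next
      show "\<not> (sym_work (?s (Suc i)) \<le> 3 \<or> sym_work (?s (Suc i)) = 30)"
        using i len m base_cells_nth[OF cs i] by (auto simp: sym_work_Suc cs'_def simp del: sym_work.simps)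
    qed
    then have l: "runs x (Loop (\<lambda>_ s. s \<le> 3 \<or> s = 30) (Shift Rt)) (h, 30 # cs', 0, out') (Suc (Suc i * Suc 1))
        (h, 30 # cs', Suc i, out')" .
    have restored: "cs'[i := unmark (cs' ! i)] = cs" using i m by (simp add: cs'_def)
    have w2: "runs x (Write unmark) (h, 30 # cs', Suc i, out') 1 (h, 30 # cs, Suc i, out')"
      using runs_Write_cell[of i cs' unmark x h out'] i len m c unfolding restored
      by (simp add: cs'_def)
    have "runs x local_body (h, 30 # cs, Suc i, out) (Suc (1 + Suc (D * n + Suc (Suc (Suc i * Suc 1) + Suc (1 + 1)))))
        (h, 30 # cs, Suc (Suc i), out')"
      unfolding local_body_def
      by (intro runs_Seq[OF w1 runs_Seq[OF e runs_Seq[OF l runs_Seq[OF w2 runs_right]]]])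
    then show ?thesis unfolding out'_def cs'_def
      by (rule runs_weaken) (use i n in \<open>simp add: algebra_simps\<close>)
  qed
  then show ?thesis by blast
qed

definition local_pass :: cmd where
  "local_pass = Seq (Shift Rt) (Seq (Loop (\<lambda>_ s. s \<noteq> 0) local_body) rewind)"

lemma runs_local_pass:
  "\<exists>D. \<forall>x h cs out n. base_cells cs \<and> length cs < n \<longrightarrow>
    runs x local_pass (h, 30 # cs, 0, out) (D * n^2) (h, 30 # cs, 0, out @ enc_rows (local_rows cs))"
proof -
  obtain D where D: "\<And>x h cs i out n. base_cells cs \<Longrightarrow> i < length cs \<Longrightarrow> length cs < n \<Longrightarrow>
    runs x local_body (h, 30 # cs, Suc i, out) (D * n)
      (h, 30 # cs, Suc (Suc i), out @ enc_rows (map (\<lambda>g. block_row g (cs[i := mark 1 (cs ! i)])) local_blocks))"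
    using runs_local_body by blast
  have "runs x local_pass (h, 30 # cs, 0, out) ((D + 10) * n^2) (h, 30 # cs, 0, out @ enc_rows (local_rows cs))"
    if cs: "base_cells cs" and n: "length cs < n" for x h cs out n
  proof -
    let ?r = "\<lambda>i. map (\<lambda>g. block_row g (cs[i := mark 1 (cs ! i)])) local_blocks"
    let ?s = "\<lambda>i. (h, 30 # cs, Suc i, out @ enc_rows (concat (map ?r [0..<i])))"
    let ?m = "length cs"
    have "runs x (Loop (\<lambda>_ s. s \<noteq> 0) local_body) (?s 0) (Suc (?m * Suc (D * n))) (?s ?m)"
    proof (rule runs_Loop[where s = ?s])
      fix i assume i: "i < ?m"
      have "sym_work (?s i) \<noteq> 0"
        using i base_cells_nth[OF cs i] by (auto simp: sym_work_Suc simp del: sym_work.simps)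
      moreover have "runs x local_body (?s i) (D * n) (?s (Suc i))"
        using D[OF cs i n, of x h "out @ enc_rows (concat (map ?r [0..<i]))"] by simp
      ultimately show "sym_work (?s i) \<noteq> 0 \<and> runs x local_body (?s i) (D * n) (?s (Suc i))" by blast
    qed (simp add: sym_work_Suc del: sym_work.simps)
    then have l: "runs x (Loop (\<lambda>_ s. s \<noteq> 0) local_body) (h, 30 # cs, Suc 0, out) (Suc (?m * Suc (D * n)))
        (h, 30 # cs, Suc ?m, out @ enc_rows (local_rows cs))"
      by (simp add: local_rows_def)
    have "runs x local_pass (h, 30 # cs, 0, out) (Suc (1 + Suc (Suc (?m * Suc (D * n)) + (2 * Suc ?m + 1))))
        (h, 30 # cs, 0, out @ enc_rows (local_rows cs))"
      unfolding local_pass_def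
      by (intro runs_Seq[OF runs_right runs_Seq[OF l runs_rewind[OF base_cells_valid[OF cs]]]])
    then show ?thesis
    proof (rule runs_weaken)
      have "Suc (1 + Suc (Suc (?m * Suc (D * n)) + (2 * Suc ?m + 1))) \<le> ?m * (D * n) + 10 * n"
        using n by (simp add: algebra_simps)
      also have "\<dots> \<le> n * (D * n) + 10 * (n * n)"
        using n by (intro add_mono mult_le_mono) auto
      also have "\<dots> = (D + 10) * n^2" by (simp add: power2_eq_square algebra_simps)
      finally show "Suc (1 + Suc (Suc (?m * Suc (D * n)) + (2 * Suc ?m + 1))) \<le> (D + 10) * n^2" .
    qed
  qed
  then show ?thesis by blast
qed

section \<open>Reading unary numbers and building the cells\<close>

definition ones :: "bool list \<Rightarrow> nat \<Rightarrow> nat" where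
  "ones x h = length (takeWhile id (drop h x))"

lemma contents_drop:
  "contents x (int h) = (case drop h x of [] \<Rightarrow> 0 | b # _ \<Rightarrow> if b then 2 else 1)"
proof (cases "h < length x")
  case True
  then show ?thesis by (simp add: contents_def Cons_nth_drop_Suc[symmetric])
qed (simp add: contents_def)

lemma contents_ones: "i < ones x h \<Longrightarrow> contents x (int (h + i)) = 2"
proof -
  assume i: "i < ones x h"
  then have len: "i < length (drop h x)"
    unfolding ones_def using length_takeWhile_le order_less_le_trans by blast
  have "takeWhile id (drop h x) ! i"
    using i set_takeWhileD[of _ id "drop h x"] nth_mem unfolding ones_def by fastforce
  then have "drop h x ! i" using i by (simp add: takeWhile_nth ones_def)
  then show ?thesis using len by (simp add: contents_def nat_add_distrib)
qed

lemma contents_ones_end: "contents x (int (h + ones x h)) \<noteq> 2"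
proof (cases "ones x h < length (drop h x)")
  case True
  then have "\<not> drop h x ! ones x h" unfolding ones_def using nth_length_takeWhile by fastforce
  then show ?thesis using True by (simp add: contents_def nat_add_distrib)
next
  case False
  then show ?thesis by (auto simp: contents_def)
qed

lemma ones_le: "ones x h \<le> length x"
  unfolding ones_def using length_takeWhile_le[of id "drop h x"] by simp

definition copy_unary :: "nat \<Rightarrow> cmd" where
  "copy_unary v = Seq (Loop (\<lambda>i _. i = 2) (Seq (Write (\<lambda>_. v)) (Seq (Shift Rt) Advance)))
     (Seq (Write (\<lambda>_. 1)) (Seq (Shift Rt) Advance))"

lemma runs_append:
  assumes "v < 32"
  shows "runs x (Seq (Write (\<lambda>_. v)) (Seq (Shift Rt) Advance)) (h, ps, length ps, out) 5
    (Suc h, ps @ [v], length (ps @ [v]), out)"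
proof -
  have "runs x (Write (\<lambda>_. v)) (h, ps, length ps, out) 1 (h, ps @ [v], length ps, out)"
    using runs_Write_end[of x "\<lambda>_. v"] assms by simp
  from runs_Seq[OF this runs_Seq[OF runs_right runs_Advance]] show ?thesis
    by (simp add: eval_nat_numeral)
qed

lemma runs_copy_unary:
  assumes "v < 32"
  shows "runs x (copy_unary v) (h, ps, length ps, out) (6 * ones x h + 7)
    (h + ones x h + 1, ps @ replicate (ones x h) v @ [1], length (ps @ replicate (ones x h) v @ [1]), out)"
proof -
  let ?s = "\<lambda>i. (h + i, ps @ replicate i v, length (ps @ replicate i v), out)"
  let ?m = "ones x h"
  have "runs x (Loop (\<lambda>i _. i = 2) (Seq (Write (\<lambda>_. v)) (Seq (Shift Rt) Advance))) (?s 0) (Suc (?m * Suc 5)) (?s ?m)"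
  proof (rule runs_Loop[where s = ?s])
    fix i assume i: "i < ?m"
    have "runs x (Seq (Write (\<lambda>_. v)) (Seq (Shift Rt) Advance)) (?s i) 5 (?s (Suc i))"
      using runs_append[OF assms, of x "h + i" "ps @ replicate i v" out]
      by (simp add: replicate_append_same)
    then show "sym_in x (?s i) = 2 \<and> runs x (Seq (Write (\<lambda>_. v)) (Seq (Shift Rt) Advance)) (?s i) 5 (?s (Suc i))"
      using contents_ones[OF i] by simp
  next
    show "\<not> sym_in x (?s ?m) = 2" using contents_ones_end[of x h] by simp
  qed
  then have l: "runs x (Loop (\<lambda>i _. i = 2) (Seq (Write (\<lambda>_. v)) (Seq (Shift Rt) Advance)))
      (h, ps, length ps, out) (Suc (?m * Suc 5)) (?s ?m)" by simp
  have a: "runs x (Seq (Write (\<lambda>_. 1)) (Seq (Shift Rt) Advance)) (?s ?m) 5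
      (h + ?m + 1, ps @ replicate ?m v @ [1], length (ps @ replicate ?m v @ [1]), out)"
    using runs_append[of 1 x "h + ?m" "ps @ replicate ?m v" out] by simp
  show ?thesis unfolding copy_unary_def
    by (rule runs_weaken[OF runs_Seq[OF l a]]) simp
qed

definition copy_prefix :: cmd where
  "copy_prefix = Seq (Write (\<lambda>_. 30)) (Seq (Shift Rt) (Seq (copy_unary 2) (Seq (copy_unary 3) rewind)))"

text \<open>Defined from the run lengths of an arbitrary bit string, since the time bound has to
  hold for all inputs; a missing number counts as 0.\<close>

definition prefix_cells :: "bool list \<Rightarrow> nat list" where
  "prefix_cells x = cells (ones x 0) (ones x (Suc (ones x 0)))"

definition prefix_end :: "bool list \<Rightarrow> nat" where
  "prefix_end x = ones x 0 + ones x (Suc (ones x 0)) + 2"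

lemma base_prefix_cells: "base_cells (prefix_cells x)"
  unfolding base_cells_def prefix_cells_def using cells_set by blast

lemma ones_add_le: "ones x h + h \<le> max h (length x)"
  unfolding ones_def using length_takeWhile_le[of id "drop h x"] by simp

lemma prefix_length: "length (prefix_cells x) \<le> length x + 2"
  using ones_add_le[of x "Suc (ones x 0)"] ones_le[of x 0] by (simp add: prefix_cells_def cells_length)

lemma runs_copy_prefix:
  assumes "length x + 2 < n"
  shows "runs x copy_prefix (0, [], 0, []) (100 * n) (prefix_end x, 30 # prefix_cells x, 0, [])"
proof -
  let ?a = "ones x 0" and ?e = "ones x (Suc (ones x 0))"
  have w: "runs x (Write (\<lambda>_. 30)) (0, [], 0, []) 1 (0, [30], 0, [])"
    using runs_Write_end[of x "\<lambda>_. 30" 0 "[]" "[]"] by simp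
  have c1: "runs x (copy_unary 2) (0, [30], Suc 0, []) (6 * ?a + 7)
      (Suc ?a, [30] @ replicate ?a 2 @ [1], length ([30] @ replicate ?a 2 @ [1]), [])"
    using runs_copy_unary[of 2 x 0 "[30]" "[]"] by simp
  have c2: "runs x (copy_unary 3) (Suc ?a, [30] @ replicate ?a 2 @ [1], length ([30] @ replicate ?a 2 @ [1]), [])
      (6 * ?e + 7) (prefix_end x, 30 # prefix_cells x, length (30 # prefix_cells x), [])"
    using runs_copy_unary[of 3 x "Suc ?a" "[30] @ replicate ?a 2 @ [1]" "[]"]
    by (simp add: prefix_end_def prefix_cells_def cells_def)
  have "runs x copy_prefix (0, [], 0, [])
      (Suc (1 + Suc (1 + Suc ((6 * ?a + 7) + Suc ((6 * ?e + 7) + (2 * length (30 # prefix_cells x) + 1))))))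
      (prefix_end x, 30 # prefix_cells x, 0, [])"
    unfolding copy_prefix_def
    by (rule runs_Seq[OF w runs_Seq[OF runs_right runs_Seq[OF c1 runs_Seq[OF c2
        runs_rewind[OF base_cells_valid[OF base_prefix_cells]]]]]])
  then show ?thesis
    by (rule runs_weaken) (use assms prefix_length[of x] ones_le[of x 0] ones_le[of x "Suc (ones x 0)"] in simp)
qed

section \<open>Locating and marking a literal\<close>

definition seek_separator :: cmd where
  "seek_separator = Seq (Loop (\<lambda>_ s. s \<noteq> 0 \<and> s mod 3 \<noteq> 1) (Shift Rt)) (Cond (\<lambda>_ s. s \<noteq> 0) (Shift Rt) Skip)"

text \<open>Marks preserve residues modulo 3, so the separator is recognised even in a list that
  already carries marks. The \<open>min\<close> covers a list without separator.\<close>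

definition separator :: "nat list \<Rightarrow> nat" where
  "separator cs = min (length cs) (Suc (length (takeWhile (\<lambda>s. s mod 3 \<noteq> 1) cs)))"

text \<open>Saturation at the first blank: an index beyond the last cell leaves the head there, so
  later commands still find it at most one place behind the list.\<close>

lemma runs_step_right:
  assumes "valid_cells cs" "k \<le> length cs"
  shows "runs x (Cond (\<lambda>_ s. s \<noteq> 0) (Shift Rt) Skip) (h, 30 # cs, Suc k, out) 2
    (h, 30 # cs, Suc (min (length cs) (Suc k)), out)"
proof (cases "k < length cs")
  case True
  have "runs x (Cond (\<lambda>_ s. s \<noteq> 0) (Shift Rt) Skip) (h, 30 # cs, Suc k, out) (Suc 1)
      (h, 30 # cs, Suc (Suc k), out)"
    using valid_cells_nth[OF assms(1) True] True
    by (intro runs_Cond_True[OF _ runs_right]) (simp add: sym_work_Suc del: sym_work.simps)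
  moreover have "min (length cs) (Suc k) = Suc k" using True by simp
  ultimately show ?thesis by (simp only: numeral_2_eq_2 One_nat_def)
next
  case False
  then have "runs x (Cond (\<lambda>_ s. s \<noteq> 0) (Shift Rt) Skip) (h, 30 # cs, Suc k, out) (Suc 1)
      (h, 30 # cs, Suc k, out)"
    by (intro runs_Cond_False[OF _ runs_Skip]) (simp add: sym_work_Suc del: sym_work.simps)
  then show ?thesis using False assms(2) by (simp add: min_def numeral_2_eq_2)
qed

lemma runs_seek_separator:
  assumes "valid_cells cs"
  shows "runs x seek_separator (h, 30 # cs, Suc 0, out) (2 * length cs + 4)
    (h, 30 # cs, Suc (separator cs), out)"
proof -
  let ?j = "length (takeWhile (\<lambda>s. s mod 3 \<noteq> 1) cs)"
  let ?s = "\<lambda>i. (h, 30 # cs, Suc i, out)"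
  have j: "?j \<le> length cs" by (rule length_takeWhile_le)
  have "runs x (Loop (\<lambda>_ s. s \<noteq> 0 \<and> s mod 3 \<noteq> 1) (Shift Rt)) (?s 0) (Suc (?j * Suc 1)) (?s ?j)"
  proof (rule runs_Loop[where s = ?s])
    fix i assume i: "i < ?j"
    then have "cs ! i mod 3 \<noteq> 1"
      using set_takeWhileD[of "cs ! i" "\<lambda>s. s mod 3 \<noteq> 1" cs] nth_mem[OF i] by (simp add: takeWhile_nth)
    moreover have "i < length cs" using i j by simp
    ultimately have "sym_work (?s i) \<noteq> 0 \<and> sym_work (?s i) mod 3 \<noteq> 1"
      using valid_cells_nth[OF assms, of i] by (simp add: sym_work_Suc del: sym_work.simps)
    then show "(sym_work (?s i) \<noteq> 0 \<and> sym_work (?s i) mod 3 \<noteq> 1) \<and> runs x (Shift Rt) (?s i) 1 (?s (Suc i))"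
      using runs_right by blast
  next
    show "\<not> (sym_work (?s ?j) \<noteq> 0 \<and> sym_work (?s ?j) mod 3 \<noteq> 1)"
      using nth_length_takeWhile[of "\<lambda>s. s mod 3 \<noteq> 1" cs] by (auto simp: sym_work_Suc simp del: sym_work.simps)
  qed
  then have l: "runs x (Loop (\<lambda>_ s. s \<noteq> 0 \<and> s mod 3 \<noteq> 1) (Shift Rt)) (h, 30 # cs, Suc 0, out)
      (Suc (?j * Suc 1)) (h, 30 # cs, Suc ?j, out)" .
  show ?thesis
    unfolding seek_separator_def separator_def
    by (rule runs_weaken[OF runs_Seq[OF l runs_step_right[OF assms j]]]) (use j in simp)
qed

definition count_unary :: cmd where
  "count_unary = Loop (\<lambda>i _. i = 2) (Seq (Cond (\<lambda>_ s. s \<noteq> 0) (Shift Rt) Skip) Advance)"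

lemma runs_count_unary:
  assumes "valid_cells cs" "q \<le> length cs"
  shows "runs x count_unary (h, 30 # cs, Suc q, out) (5 * ones x h + 1)
    (h + ones x h, 30 # cs, Suc (min (length cs) (q + ones x h)), out)"
proof -
  let ?m = "ones x h"
  let ?s = "\<lambda>i. (h + i, 30 # cs, Suc (min (length cs) (q + i)), out)"
  have "runs x count_unary (?s 0) (Suc (?m * Suc (Suc (2 + 1)))) (?s ?m)"
    unfolding count_unary_def
  proof (rule runs_Loop[where s = ?s])
    fix i assume i: "i < ?m"
    have eq: "min (length cs) (Suc (min (length cs) (q + i))) = min (length cs) (q + Suc i)" by simp
    have "runs x (Cond (\<lambda>_ s. s \<noteq> 0) (Shift Rt) Skip) (?s i) 2
        (h + i, 30 # cs, Suc (min (length cs) (q + Suc i)), out)"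
      using runs_step_right[OF assms(1), of "min (length cs) (q + i)" x "h + i" out] unfolding eq by simp
    from runs_Seq[OF this runs_Advance]
    have "runs x (Seq (Cond (\<lambda>_ s. s \<noteq> 0) (Shift Rt) Skip) Advance) (?s i) (Suc (2 + 1)) (?s (Suc i))"
      by simp
    then show "sym_in x (?s i) = 2 \<and>
        runs x (Seq (Cond (\<lambda>_ s. s \<noteq> 0) (Shift Rt) Skip) Advance) (?s i) (Suc (2 + 1)) (?s (Suc i))"
      using contents_ones[OF i] by simp
  next
    show "\<not> sym_in x (?s ?m) = 2" using contents_ones_end[of x h] by simp
  qed
  moreover have "min (length cs) (q + 0) = q" using assms(2) by simp
  ultimately have "runs x count_unary (h, 30 # cs, Suc q, out) (Suc (?m * Suc (Suc (2 + 1)))) (?s ?m)"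
    by (simp only: add_0_right)
  then show ?thesis by (rule runs_weaken) simp
qed

definition read_literal :: "nat \<Rightarrow> cmd" where
  "read_literal k = Seq Advance (Seq (Shift Rt) (Seq (Cond (\<lambda>i _. i = 2) seek_separator Skip)
     (Seq Advance (Seq count_unary (Seq Advance
     (Seq (Cond (\<lambda>i _. i = 2) (Write (mark (literal_code k True))) (Write (mark (literal_code k False))))
     (Seq Advance rewind)))))))"

definition literal_start :: "bool list \<Rightarrow> nat \<Rightarrow> nat list \<Rightarrow> nat" where
  "literal_start x h cs = (if contents x (int h) = 2 then separator cs else 0)"

text \<open>The 4 counts the list bit, the tag of the variable, the end of the unary index and the
  sign bit.\<close>

definition literal_end :: "bool list \<Rightarrow> nat \<Rightarrow> nat" where
  "literal_end x h = h + 4 + ones x (h + 2)"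

text \<open>At \<open>q = length cs\<close> the update is void, so a literal with an index out of
  range leaves the cells unchanged, in accordance with \<open>runs_mark\<close>.\<close>

definition literal_cells :: "bool list \<Rightarrow> nat \<Rightarrow> nat \<Rightarrow> nat list \<Rightarrow> nat list" where
  "literal_cells x k h cs =
     (let q = min (length cs) (literal_start x (h + 1) cs + ones x (h + 2))
      in cs[q := mark (literal_code k (contents x (int (h + 3 + ones x (h + 2))) = 2)) (cs ! q)])"

lemma literal_code_le: "k < 3 \<Longrightarrow> literal_code k b \<le> 6"
  by (simp add: literal_code_def)

lemma runs_mark:
  assumes "valid_cells cs" "q \<le> length cs" "c \<le> 6"
  shows "runs x (Write (mark c)) (h, 30 # cs, Suc q, out) 1 (h, 30 # cs[q := mark c (cs ! q)], Suc q, out)"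
proof (cases "q < length cs")
  case True
  then show ?thesis
    using mark_range[of "cs ! q" c] valid_cells_nth[OF assms(1) True] assms(3)
    by (intro runs_Write_cell) auto
next
  case False
  then have q: "Suc q = length (30 # cs)" "cs[q := mark c (cs ! q)] = cs" using assms(2) by (simp_all add: list_update_beyond)
  show ?thesis unfolding q by (rule runs_Write_blank) (simp add: mark_def)
qed

lemma literal_cells_valid:
  assumes "valid_cells cs" "k < 3"
  shows "valid_cells (literal_cells x k h cs)" "length (literal_cells x k h cs) = length cs"
proof -
  let ?q = "min (length cs) (literal_start x (h + 1) cs + ones x (h + 2))"
  show "length (literal_cells x k h cs) = length cs" by (simp add: literal_cells_def Let_def)
  show "valid_cells (literal_cells x k h cs)"
  proof (cases "?q < length cs")
    case True
    then show ?thesis unfolding literal_cells_def Let_def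
      using assms mark_range[OF _ _ literal_code_le[OF assms(2)]] valid_cells_nth[OF assms(1) True]
      by (intro valid_cells_update) blast+
  next
    case False
    then have "literal_cells x k h cs = cs" by (simp add: literal_cells_def Let_def list_update_beyond)
    then show ?thesis using assms by simp
  qed
qed

lemma runs_read_literal:
  assumes cs: "valid_cells cs" and k: "k < 3" and n: "length cs < n" "length x < n"
  shows "runs x (read_literal k) (h, 30 # cs, 0, out) (100 * n)
    (literal_end x h, 30 # literal_cells x k h cs, 0, out)"
proof -
  let ?p = "literal_start x (h + 1) cs" and ?i = "ones x (h + 2)"
  let ?q = "min (length cs) (?p + ?i)"
  have p: "?p \<le> length cs" by (simp add: literal_start_def separator_def)
  have s: "runs x (Cond (\<lambda>i _. i = 2) seek_separator Skip) (h + 1, 30 # cs, Suc 0, out)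
      (Suc (2 * length cs + 4)) (h + 1, 30 # cs, Suc ?p, out)"
  proof (cases "contents x (int (h + 1)) = 2")
    case True
    then have p_eq: "?p = separator cs" by (simp add: literal_start_def)
    show ?thesis unfolding p_eq
      by (rule runs_Cond_True[OF _ runs_seek_separator[OF cs]]) (use True in simp)
  next
    case False
    then have p_eq: "?p = 0" by (simp add: literal_start_def)
    have "runs x (Cond (\<lambda>i _. i = 2) seek_separator Skip) (h + 1, 30 # cs, Suc 0, out)
      (Suc 1) (h + 1, 30 # cs, Suc 0, out)"
      by (rule runs_Cond_False[OF _ runs_Skip]) (use False in simp)
    then show ?thesis unfolding p_eq by (rule runs_weaken) simp
  qed
  have c: "runs x count_unary (h + 2, 30 # cs, Suc ?p, out) (5 * ?i + 1) (h + 2 + ?i, 30 # cs, Suc ?q, out)"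
    by (rule runs_count_unary[OF cs p])
  have w: "runs x (Cond (\<lambda>i _. i = 2) (Write (mark (literal_code k True))) (Write (mark (literal_code k False))))
      (h + 3 + ?i, 30 # cs, Suc ?q, out) (Suc 1) (h + 3 + ?i, 30 # literal_cells x k h cs, Suc ?q, out)"
  proof (cases "contents x (int (h + 3 + ?i)) = 2")
    case True
    have "runs x (Cond (\<lambda>i _. i = 2) (Write (mark (literal_code k True))) (Write (mark (literal_code k False))))
      (h + 3 + ?i, 30 # cs, Suc ?q, out) (Suc 1)
      (h + 3 + ?i, 30 # cs[?q := mark (literal_code k True) (cs ! ?q)], Suc ?q, out)"
      by (rule runs_Cond_True[OF _ runs_mark[OF cs min.cobounded1 literal_code_le[OF k]]])
         (use True in simp)
    moreover have "(contents x (int (h + 3 + ?i)) = 2) = True" using True by blast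
    then have "literal_cells x k h cs = cs[?q := mark (literal_code k True) (cs ! ?q)]"
      by (simp only: literal_cells_def Let_def)
    ultimately show ?thesis by simp
  next
    case False
    have "runs x (Cond (\<lambda>i _. i = 2) (Write (mark (literal_code k True))) (Write (mark (literal_code k False))))
      (h + 3 + ?i, 30 # cs, Suc ?q, out) (Suc 1)
      (h + 3 + ?i, 30 # cs[?q := mark (literal_code k False) (cs ! ?q)], Suc ?q, out)"
      by (rule runs_Cond_False[OF _ runs_mark[OF cs min.cobounded1 literal_code_le[OF k]]])
         (use False in simp)
    moreover have "literal_cells x k h cs = cs[?q := mark (literal_code k False) (cs ! ?q)]"
      using False by (simp only: literal_cells_def Let_def)
    ultimately show ?thesis by simp
  qed
  have a: "runs x Advance (h, ps, j, out) 1 (h + 1, ps, j, out)" for h ps j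
    using runs_Advance by simp
  have a1: "runs x Advance (h + 1, ps, j, out) 1 (h + 2, ps, j, out)" for ps j
    using runs_Advance[of x "h + 1"] by simp
  have a2: "runs x Advance (h + 2 + ?i, ps, j, out) 1 (h + 3 + ?i, ps, j, out)" for ps j
    using runs_Advance[of x "h + 2 + ?i"] by (simp add: numeral_3_eq_3)
  have a3: "runs x Advance (h + 3 + ?i, ps, j, out) 1 (literal_end x h, ps, j, out)" for ps j
  proof -
    have "literal_end x h = Suc (h + 3 + ?i)" by (simp add: literal_end_def)
    then show ?thesis by (simp only: runs_Advance)
  qed
  have "runs x (read_literal k) (h, 30 # cs, 0, out)
      (Suc (1 + Suc (1 + Suc (Suc (2 * length cs + 4) + Suc (1 + Suc ((5 * ?i + 1) + Suc (1 + Suc (Suc 1 +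
        Suc (1 + (2 * Suc ?q + 1)))))))))) (literal_end x h, 30 # literal_cells x k h cs, 0, out)"
    unfolding read_literal_def
    by (rule runs_Seq[OF a runs_Seq[OF runs_right runs_Seq[OF s runs_Seq[OF a1 runs_Seq[OF c runs_Seq[OF a2
        runs_Seq[OF w runs_Seq[OF a3 runs_rewind[OF literal_cells_valid(1)[OF cs k]]]]]]]]]])
  then show ?thesis
    by (rule runs_weaken) (use n ones_le[of x "h + 2"] in \<open>simp add: min_def\<close>)
qed

section \<open>Processing a constraint\<close>

definition clear_marks :: cmd where
  "clear_marks = Seq (Shift Rt) (Seq (Loop (\<lambda>_ s. s \<noteq> 0) (Seq (Write unmark) (Shift Rt))) rewind)"

lemma map_unmark_valid:
  assumes "valid_cells cs"
  shows "valid_cells (map unmark cs)"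
  unfolding valid_cells_def
proof
  fix t assume "t \<in> set (map unmark cs)"
  then obtain s where s: "s \<in> set cs" "t = unmark s" by auto
  then have "0 < s" "s < 30" using assms unfolding valid_cells_def by auto
  then show "t \<in> {1..<30}" using unmark_range[of s] s(2) by simp
qed

lemma runs_clear_marks:
  assumes "valid_cells cs"
  shows "runs x clear_marks (h, 30 # cs, 0, out) (10 * length cs + 10) (h, 30 # map unmark cs, 0, out)"
proof -
  let ?c = "\<lambda>i. map unmark (take i cs) @ drop i cs"
  let ?s = "\<lambda>i. (h, 30 # ?c i, Suc i, out)"
  let ?m = "length cs"
  have "runs x (Loop (\<lambda>_ s. s \<noteq> 0) (Seq (Write unmark) (Shift Rt))) (?s 0) (Suc (?m * Suc (Suc (1 + 1)))) (?s ?m)"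
  proof (rule runs_Loop[where s = ?s])
    fix i assume i: "i < ?m"
    have ci: "?c i ! i = cs ! i" using i by (simp add: nth_append)
    have d: "drop i cs = cs ! i # drop (Suc i) cs" using i by (rule Cons_nth_drop_Suc[symmetric])
    have upd: "(?c i)[i := unmark (cs ! i)] = ?c (Suc i)"
      unfolding d using i by (simp add: list_update_append take_Suc_conv_app_nth)
    have "unmark (cs ! i) < 31" using unmark_range[of "cs ! i"] valid_cells_nth[OF assms i] by simp
    then have "runs x (Write unmark) (?s i) 1 (h, 30 # ?c (Suc i), Suc i, out)"
      using runs_Write_cell[of i "?c i" unmark x h out] i unfolding ci upd by fastforce
    from runs_Seq[OF this runs_right]
    have "runs x (Seq (Write unmark) (Shift Rt)) (?s i) (Suc (1 + 1)) (?s (Suc i))" .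
    moreover have "sym_work (?s i) \<noteq> 0"
      unfolding sym_work_Suc ci using i valid_cells_nth[OF assms i] by simp
    ultimately show "sym_work (?s i) \<noteq> 0 \<and> runs x (Seq (Write unmark) (Shift Rt)) (?s i) (Suc (1 + 1)) (?s (Suc i))"
      by blast
  next
    show "\<not> sym_work (?s ?m) \<noteq> 0" unfolding sym_work_Suc by simp
  qed
  then have l: "runs x (Loop (\<lambda>_ s. s \<noteq> 0) (Seq (Write unmark) (Shift Rt))) (h, 30 # cs, Suc 0, out)
      (Suc (?m * Suc (Suc (1 + 1)))) (h, 30 # map unmark cs, Suc ?m, out)" by simp
  show ?thesis unfolding clear_marks_def
    by (rule runs_weaken[OF runs_Seq[OF runs_right runs_Seq[OF l runs_rewind[OF map_unmark_valid[OF assms]]]]])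
       simp
qed

definition clause_end :: "bool list \<Rightarrow> nat \<Rightarrow> nat" where
  "clause_end x h = Suc (literal_end x (literal_end x (literal_end x (Suc h))))"

definition clause_cells :: "bool list \<Rightarrow> nat list \<Rightarrow> nat \<Rightarrow> nat list" where
  "clause_cells x cs h =
     (let h1 = literal_end x (Suc h); h2 = literal_end x h1
      in literal_cells x 2 h2 (literal_cells x 1 h1 (literal_cells x 0 (Suc h) cs)))"

definition clause_body :: cmd where
  "clause_body = Seq Advance (Seq (read_literal 0) (Seq (read_literal 1) (Seq (read_literal 2)
     (Seq Advance (Seq (emit_rows clause_blocks) clear_marks)))))"

text \<open>Marks change nothing up to \<open>unmark\<close>, so clearing all cells restores the
  list without any record of the positions that were hit. This holds for every input, including
  repeated variables.\<close>

lemma map_unmark_literal_cells: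
  assumes "valid_cells cs" "k < 3"
  shows "map unmark (literal_cells x k h cs) = map unmark cs"
proof -
  let ?q = "min (length cs) (literal_start x (h + 1) cs + ones x (h + 2))"
  show ?thesis
  proof (cases "?q < length cs")
    case True
    then show ?thesis
      using unmark_mark[OF _ _ literal_code_le[OF assms(2)]] valid_cells_nth[OF assms(1) True]
      by (simp add: literal_cells_def Let_def map_update) (metis list_update_id map_update)
  qed (simp add: literal_cells_def Let_def list_update_beyond)
qed

lemma map_unmark_base: "base_cells cs \<Longrightarrow> map unmark cs = cs"
  unfolding base_cells_def by (intro map_idI) (auto simp: unmark_def)

lemma runs_clause_body:
  "\<exists>D. \<forall>x h cs out n. base_cells cs \<and> length cs < n \<and> length x < n \<longrightarrow>
    runs x clause_body (h, 30 # cs, 0, out) (D * n)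
      (clause_end x h, 30 # cs, 0, out @ enc_rows (clause_rows (clause_cells x cs h)))"
proof -
  obtain D where D: "\<And>x h cs k out n. valid_cells cs \<Longrightarrow> k \<le> Suc (length cs) \<Longrightarrow> length cs < n \<Longrightarrow>
    runs x (emit_rows clause_blocks) (h, 30 # cs, k, out) (D * n)
      (h, 30 # cs, 0, out @ enc_rows (map (\<lambda>g. block_row g cs) clause_blocks))"
    using runs_emit_rows[of clause_blocks] by blast
  have "runs x clause_body (h, 30 # cs, 0, out) ((D + 400) * n)
      (clause_end x h, 30 # cs, 0, out @ enc_rows (clause_rows (clause_cells x cs h)))"
    if cs: "base_cells cs" and n: "length cs < n" "length x < n" for x h cs out n
  proof -
    define h1 where "h1 = literal_end x (Suc h)"
    define h2 where "h2 = literal_end x h1"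
    define c1 where "c1 = literal_cells x 0 (Suc h) cs"
    define c2 where "c2 = literal_cells x 1 h1 c1"
    define c3 where "c3 = literal_cells x 2 h2 c2"
    have v: "valid_cells cs" "valid_cells c1" "valid_cells c2" "valid_cells c3"
      "length c1 = length cs" "length c2 = length cs" "length c3 = length cs"
      using base_cells_valid[OF cs] by (simp_all add: c1_def c2_def c3_def literal_cells_valid)
    have c3: "clause_cells x cs h = c3"
      by (simp add: clause_cells_def Let_def c1_def c2_def c3_def h1_def h2_def)
    have u: "map unmark c3 = cs"
      using v map_unmark_base[OF cs] by (simp add: c3_def c2_def c1_def map_unmark_literal_cells literal_cells_valid)
    let ?out = "out @ enc_rows (clause_rows c3)"
    have r1: "runs x (read_literal 0) (Suc h, 30 # cs, 0, out) (100 * n) (h1, 30 # c1, 0, out)"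
      unfolding h1_def c1_def by (rule runs_read_literal) (use v n in simp_all)
    have r2: "runs x (read_literal 1) (h1, 30 # c1, 0, out) (100 * n) (h2, 30 # c2, 0, out)"
      unfolding h2_def c2_def by (rule runs_read_literal) (use v n in simp_all)
    have r3: "runs x (read_literal 2) (h2, 30 # c2, 0, out) (100 * n) (literal_end x h2, 30 # c3, 0, out)"
      unfolding c3_def by (rule runs_read_literal) (use v n in simp_all)
    have e: "runs x (emit_rows clause_blocks) (Suc (literal_end x h2), 30 # c3, 0, out) (D * n)
        (Suc (literal_end x h2), 30 # c3, 0, ?out)"
      unfolding clause_rows_def by (rule D) (use v n in simp_all)
    have cl: "runs x clear_marks (Suc (literal_end x h2), 30 # c3, 0, ?out) (10 * length cs + 10)
        (clause_end x h, 30 # cs, 0, ?out)"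
      using runs_clear_marks[OF v(4), of x "Suc (literal_end x h2)" ?out]
      by (simp add: u v clause_end_def h1_def h2_def)
    show ?thesis unfolding clause_body_def c3
      by (rule runs_weaken[OF runs_Seq[OF runs_Advance runs_Seq[OF r1 runs_Seq[OF r2 runs_Seq[OF r3
          runs_Seq[OF runs_Advance runs_Seq[OF e cl]]]]]]]) (use n in \<open>simp add: algebra_simps\<close>)
  qed
  then show ?thesis by blast
qed

section \<open>The whole program and its running time\<close>

definition clause_start :: "bool list \<Rightarrow> nat \<Rightarrow> nat" where
  "clause_start x i = (clause_end x ^^ i) (prefix_end x)"

definition clause_count :: "bool list \<Rightarrow> nat" where
  "clause_count x = (LEAST i. contents x (int (clause_start x i)) \<noteq> 2)"

definition reduction_output :: "bool list \<Rightarrow> bool list" where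
  "reduction_output x = enc_rows (local_rows (prefix_cells x)) @
     enc_rows (concat (map (\<lambda>i. clause_rows (clause_cells x (prefix_cells x) (clause_start x i)))
       [0..<clause_count x])) @ False # enc_rat 4"

text \<open>Each round consumes at least one input symbol. After \<open>length x\<close> rounds the
  head reads a blank, so the \<open>LEAST\<close> in \<open>clause_count\<close> is attained and at
  most \<open>length x\<close>.\<close>

lemma clause_start_ge: "i \<le> clause_start x i"
  by (induction i) (auto simp: clause_start_def clause_end_def literal_end_def)

lemma clause_start_end: "contents x (int (clause_start x (length x))) \<noteq> 2"
  using clause_start_ge[of "length x" x] by (simp add: contents_def)

lemma clause_count_le: "clause_count x \<le> length x"
  unfolding clause_count_def by (rule Least_le) (rule clause_start_end)

definition reduction :: cmd where
  "reduction = Seq copy_prefix (Seq local_pass (Seq (Loop (\<lambda>i _. i = 2) clause_body) (emit_word (False # enc_rat 4))))"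

text \<open>The local pass is quadratic, and at most \<open>length x\<close> rounds of linear cost
  follow. The shift by 3 makes \<open>n\<close> exceed the number of cells, which is at most
  \<open>length x + 2\<close>.\<close>

lemma runs_reduction:
  "\<exists>D. \<forall>x. \<exists>s. runs x reduction (0, [], 0, []) (D * (length x + 3)^2) s \<and> snd (snd (snd s)) = reduction_output x"
proof -
  obtain D1 where D1: "\<And>x h cs out n. base_cells cs \<Longrightarrow> length cs < n \<Longrightarrow>
    runs x local_pass (h, 30 # cs, 0, out) (D1 * n^2) (h, 30 # cs, 0, out @ enc_rows (local_rows cs))"
    using runs_local_pass by blast
  obtain D2 where D2: "\<And>x h cs out n. base_cells cs \<Longrightarrow> length cs < n \<Longrightarrow> length x < n \<Longrightarrow>
    runs x clause_body (h, 30 # cs, 0, out) (D2 * n)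
      (clause_end x h, 30 # cs, 0, out @ enc_rows (clause_rows (clause_cells x cs h)))"
    using runs_clause_body by blast
  define W where "W = 2 * length (False # enc_rat 4) + 1"
  have "\<exists>s. runs x reduction (0, [], 0, []) ((D1 + D2 + W + 110) * (length x + 3)^2) s \<and> snd (snd (snd s)) = reduction_output x"
    for x
  proof -
    define n where "n = length x + 3"
    let ?cs = "prefix_cells x" and ?m = "clause_count x"
    have n: "length x + 2 < n" "length ?cs < n" "length x < n"
      using prefix_length[of x] by (simp_all add: n_def)
    let ?o = "\<lambda>i. enc_rows (local_rows ?cs) @
      enc_rows (concat (map (\<lambda>i. clause_rows (clause_cells x ?cs (clause_start x i))) [0..<i]))"
    let ?s = "\<lambda>i. (clause_start x i, 30 # ?cs, 0, ?o i)"
    have p: "runs x local_pass (prefix_end x, 30 # ?cs, 0, []) (D1 * n^2) (?s 0)"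
      using D1[OF base_prefix_cells n(2), of x "prefix_end x" "[]"] by (simp add: clause_start_def)
    have l: "runs x (Loop (\<lambda>i _. i = 2) clause_body) (?s 0) (Suc (?m * Suc (D2 * n))) (?s ?m)"
    proof (rule runs_Loop[where s = ?s])
      fix i assume "i < ?m"
      then have "contents x (int (clause_start x i)) = 2"
        unfolding clause_count_def using not_less_Least by blast
      moreover have "runs x clause_body (?s i) (D2 * n) (?s (Suc i))"
        using D2[OF base_prefix_cells n(2,3), of "clause_start x i" "?o i"]
        by (simp add: clause_start_def)
      ultimately show "sym_in x (?s i) = 2 \<and> runs x clause_body (?s i) (D2 * n) (?s (Suc i))" by simp
    next
      have "contents x (int (clause_start x ?m)) \<noteq> 2"
        unfolding clause_count_def by (rule LeastI) (rule clause_start_end)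
      then show "\<not> sym_in x (?s ?m) = 2" by simp
    qed
    have "runs x reduction (0, [], 0, []) (Suc (100 * n + Suc (D1 * n^2 + Suc (Suc (?m * Suc (D2 * n)) + W))))
        (clause_start x ?m, 30 # ?cs, 0, ?o ?m @ False # enc_rat 4)"
      unfolding reduction_def W_def
      by (rule runs_Seq[OF runs_copy_prefix[OF n(1)] runs_Seq[OF p runs_Seq[OF l runs_emit_word]]])
    then have "runs x reduction (0, [], 0, []) ((D1 + D2 + W + 110) * n^2)
        (clause_start x ?m, 30 # ?cs, 0, ?o ?m @ False # enc_rat 4)"
    proof (rule runs_weaken)
      have m: "?m \<le> n" using clause_count_le[of x] n(3) by simp
      have nn: "n \<le> n * n" "1 \<le> n * n" by (simp_all add: n_def)
      have "?m * (D2 * n) \<le> n * (D2 * n)" using m by (rule mult_le_mono1)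
      moreover have "W \<le> W * (n * n)" using nn by simp
      moreover have "Suc (100 * n + Suc (D1 * n^2 + Suc (Suc (?m * Suc (D2 * n)) + W))) =
          100 * n + 4 + ?m + D1 * (n * n) + ?m * (D2 * n) + W"
        by (simp add: power2_eq_square)
      ultimately have "Suc (100 * n + Suc (D1 * n^2 + Suc (Suc (?m * Suc (D2 * n)) + W))) \<le>
          100 * (n * n) + 4 * (n * n) + (n * n) + D1 * (n * n) + n * (D2 * n) + W * (n * n)"
        using m nn by linarith
      also have "\<dots> \<le> (D1 + D2 + W + 110) * n^2" by (simp add: power2_eq_square algebra_simps)
      finally show "Suc (100 * n + Suc (D1 * n^2 + Suc (Suc (?m * Suc (D2 * n)) + W))) \<le> (D1 + D2 + W + 110) * n^2" .
    qed
    moreover have "?o ?m @ False # enc_rat 4 = reduction_output x" by (simp add: reduction_output_def)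
    ultimately show ?thesis unfolding n_def by force
  qed
  then show ?thesis by blast
qed

lemma polytime_output: "polytime reduction_output"
proof -
  obtain D where D: "\<And>x. \<exists>s. runs x reduction (0, [], 0, []) (D * (length x + 3)^2) s \<and> snd (snd (snd s)) = reduction_output x"
    using runs_reduction by blast
  define p :: "nat poly" where "p = [:D:] * [:3, 1:]^2"
  show ?thesis
  proof (rule polytime_cmd[where c = reduction and p = p])
    fix x
    obtain h ps k where "runs x reduction (0, [], 0, []) (D * (length x + 3)^2) (h, ps, k, reduction_output x)"
      using D[of x] by (metis prod.collapse)
    then obtain n where n: "n \<le> D * (length x + 3)^2"
      "(cmd_step ^^ n) ([reduction], tapes x (0, [], 0, [])) = ([], tapes x (h, ps, k, reduction_output x))"
      unfolding runs_def by blast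
    have "work_tape [] = contents []" by (auto simp: work_tape_def contents_def fun_eq_iff)
    then have "tapes x (0, [], 0, []) = start_tapes x" by (simp add: start_tapes_def)
    moreover have "poly p (length x) = D * (length x + 3)^2"
      by (simp add: p_def poly_power add.commute)
    ultimately show "\<exists>n ts. n \<le> poly p (length x) \<and>
        (cmd_step ^^ n) ([reduction], start_tapes x) = ([], ts) \<and> fst (last ts) = contents (reduction_output x)"
      using n by (intro exI[of _ n] exI[of _ "tapes x (h, ps, k, reduction_output x)"]) simp
  qed
qed

section \<open>The output on encoded formulas\<close>

lemma drop_shift: "drop h x = xs @ ys \<Longrightarrow> drop (h + length xs) x = ys"
  by (metis add.commute append_eq_conv_conj drop_drop)

lemma takeWhile_replicate_stop:
  "P a \<Longrightarrow> \<not> P b \<Longrightarrow> takeWhile P (replicate m a @ b # ys) = replicate m a"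
  by (induction m) auto

lemma ones_eq: "drop h x = replicate m True @ False # ys \<Longrightarrow> ones x h = m"
  by (simp add: ones_def takeWhile_replicate_stop)

lemma mark_mod_3:
  assumes "0 < s" "s < 30"
  shows "mark c s mod 3 = s mod 3"
proof -
  have "mark c s mod 3 = Suc ((s - 1) mod 3) mod 3"
    using assms by (simp add: mark_def unmark_def)
  also have "\<dots> = s mod 3" using assms(1) by (simp only: mod_Suc_eq) simp
  finally show ?thesis .
qed

lemma separator_cells:
  assumes "map (\<lambda>s. s mod 3) cs = map (\<lambda>s. s mod 3) (cells a e)"
  shows "separator cs = Suc a"
proof -
  have "length (takeWhile (\<lambda>s. s mod 3 \<noteq> 1) cs) = length (takeWhile (\<lambda>t. t \<noteq> 1) (map (\<lambda>s. s mod 3) cs))"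
    by (simp add: takeWhile_map comp_def)
  also have "\<dots> = a"
    unfolding assms by (simp add: cells_def takeWhile_replicate_stop)
  finally have "length (takeWhile (\<lambda>s. s mod 3 \<noteq> 1) cs) = a" .
  moreover have "length cs = a + e + 2" using arg_cong[OF assms, of length] by (simp add: cells_length)
  ultimately show ?thesis by (simp add: separator_def)
qed

text \<open>The invariant between two literals: the cells agree with \<open>cells a e\<close> up to
  marks, which is all that locating the separator requires.\<close>

definition marks_of :: "nat \<Rightarrow> nat \<Rightarrow> nat list \<Rightarrow> bool" where
  "marks_of a e cs \<longleftrightarrow> valid_cells cs \<and> map (\<lambda>s. s mod 3) cs = map (\<lambda>s. s mod 3) (cells a e)"

lemma marks_of_length: "marks_of a e cs \<Longrightarrow> length cs = a + e + 2"
  unfolding marks_of_def using cells_length by (metis length_map)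

lemma read_literal_correct:
  assumes x: "drop h x = True # enc_literal l @ rest"
    and v: "fst l \<in> {..<a} <+> {..<e}" and cs: "marks_of a e cs" and k: "k < 3"
  shows "literal_cells x k h cs = mark_literal a k l cs" "drop (literal_end x h) x = rest"
    "marks_of a e (literal_cells x k h cs)"
proof -
  \<comment> \<open>Treats both kinds of variables uniformly: the tag selects where counting starts,
    the unary index how far it goes.\<close>
  have "\<exists>t i. enc_var (fst l) = t # replicate i True @ [False] \<and>
      position a (fst l) = (if t then Suc a else 0) + i"
  proof (cases "fst l")
    case (Inl i)
    then show ?thesis by (intro exI[of _ False] exI[of _ i]) (simp add: enc_var_def enc_unary_def)
  next
    case (Inr j)
    then show ?thesis by (intro exI[of _ True] exI[of _ j]) (simp add: enc_var_def enc_unary_def)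
  qed
  then obtain t i where ti: "enc_var (fst l) = t # replicate i True @ [False]"
    "position a (fst l) = (if t then Suc a else 0) + i" by blast
  have x1: "drop (h + 1) x = t # replicate i True @ False # snd l # rest"
    using drop_shift[of h x "[True]"] x ti by (simp add: enc_literal_def)
  have x2: "drop (h + 2) x = replicate i True @ False # snd l # rest"
    using drop_shift[of "h + 1" x "[t]"] x1 by simp
  have x3: "drop (h + 3 + i) x = snd l # rest"
    using drop_shift[of "h + 2" x "replicate i True @ [False]"] x2 by (simp add: numeral_3_eq_3)
  have i: "ones x (h + 2) = i" using x2 by (rule ones_eq)
  show "drop (literal_end x h) x = rest"
    using drop_shift[of "h + 3 + i" x "[snd l]"] x3 unfolding literal_end_def i
    by (simp add: eval_nat_numeral)
  have p: "position a (fst l) < length cs"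
    using position_less[OF v] marks_of_length[OF cs] by simp
  have st: "literal_start x (h + 1) cs = (if t then Suc a else 0)"
    using cs separator_cells[of cs a e] contents_drop[of x "h + 1"] x1
    by (simp add: literal_start_def marks_of_def)
  have c: "(contents x (int (h + 3 + i)) = 2) = snd l"
    using contents_drop[of x "h + 3 + i"] x3 by simp
  \<comment> \<open>On a genuine encoding the position is in range and the truncation by
    \<open>min\<close> is void.\<close>
  have q: "min (length cs) (literal_start x (h + 1) cs + i) = position a (fst l)"
    unfolding st using p ti(2) by simp
  show eq: "literal_cells x k h cs = mark_literal a k l cs"
    unfolding literal_cells_def Let_def i q c mark_literal_def ..
  have "map (\<lambda>s. s mod 3) (mark_literal a k l cs) = map (\<lambda>s. s mod 3) cs"
  proof (rule nth_equalityI)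
    fix j assume "j < length (map (\<lambda>s. s mod 3) (mark_literal a k l cs))"
    then have j: "j < length cs" by (simp add: mark_literal_def)
    then show "map (\<lambda>s. s mod 3) (mark_literal a k l cs) ! j = map (\<lambda>s. s mod 3) cs ! j"
      using p valid_cells_nth[of cs j] cs[unfolded marks_of_def, THEN conjunct1]
      by (simp add: mark_literal_def nth_list_update mark_mod_3)
  qed (simp add: mark_literal_def)
  then show "marks_of a e (literal_cells x k h cs)"
    using cs literal_cells_valid(1)[of cs k x h] k by (simp add: marks_of_def eq)
qed

lemma clause_correct:
  assumes x: "drop h x = True # enc_list enc_literal [l0, l1, l2] @ rest"
    and v: "fst l0 \<in> {..<a} <+> {..<e}" "fst l1 \<in> {..<a} <+> {..<e}" "fst l2 \<in> {..<a} <+> {..<e}"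
  shows "clause_cells x (cells a e) h = marked a e [l0, l1, l2]" "drop (clause_end x h) x = rest"
proof -
  have "valid_cells (cells a e)"
    using cells_set unfolding valid_cells_def by fastforce
  then have m0: "marks_of a e (cells a e)" by (simp add: marks_of_def)
  have x0: "drop (Suc h) x = True # enc_literal l0 @ True # enc_literal l1 @ True # enc_literal l2 @ False # rest"
    using drop_shift[of h x "[True]"] x by (simp add: enc_list_def)
  note r0 = read_literal_correct[OF x0 v(1) m0, of 0, simplified]
  note r1 = read_literal_correct[OF r0(2) v(2) r0(3), of 1, simplified]
  note r2 = read_literal_correct[OF r1(2) v(3) r1(3), of 2, simplified]
  show "clause_cells x (cells a e) h = marked a e [l0, l1, l2]"
    using r0(1) r1(1) r2(1) by (simp add: clause_cells_def Let_def marked_def)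
  show "drop (clause_end x h) x = rest"
    using drop_shift[of _ x "[False]"] r2(2) by (simp add: clause_end_def)
qed

lemma output_correct:
  assumes "nae_e3_formula \<phi>"
  shows "reduction_output (enc_formula \<phi>) = enc_crp (crp_matrix \<phi>, 4)"
proof -
  let ?a = "num_univ \<phi>" and ?e = "num_exis \<phi>" and ?C = "constraints \<phi>"
  define x where "x = enc_formula \<phi>"
  let ?L = "\<lambda>Cs. enc_list (enc_list enc_literal) Cs"
  have x: "drop 0 x = replicate ?a True @ False # replicate ?e True @ False # ?L ?C"
    by (simp add: x_def enc_formula_def enc_unary_def)
  have a: "ones x 0 = ?a" using x by (rule ones_eq)
  have x1: "drop (Suc ?a) x = replicate ?e True @ False # ?L ?C"
    using drop_shift[of 0 x "replicate ?a True @ [False]"] x by simp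
  have e: "ones x (Suc ?a) = ?e" using x1 by (rule ones_eq)
  have x2: "drop (prefix_end x) x = ?L ?C"
    using drop_shift[of "Suc ?a" x "replicate ?e True @ [False]"] x1
    by (simp add: prefix_end_def a e)
  have cs: "prefix_cells x = cells ?a ?e" by (simp add: prefix_cells_def a e)
  have step: "clause_cells x (cells ?a ?e) h = marked ?a ?e C \<and> drop (clause_end x h) x = ?L Cs"
    if "drop h x = ?L (C # Cs)" "C \<in> set ?C" for h C Cs
  proof -
    have C: "length C = 3" "fst ` set C \<subseteq> {..<?a} <+> {..<?e}"
      using assms that(2) unfolding nae_e3_formula_def by blast+
    obtain l0 l1 l2 where l: "C = [l0, l1, l2]" using C(1) by (rule length_3E)
    have d: "drop h x = True # enc_list enc_literal [l0, l1, l2] @ ?L Cs"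
      using that(1) by (simp add: enc_list_def[of "enc_list enc_literal"] l)
    have vars: "fst l0 \<in> {..<?a} <+> {..<?e}" "fst l1 \<in> {..<?a} <+> {..<?e}" "fst l2 \<in> {..<?a} <+> {..<?e}"
      using C(2) unfolding l by simp_all
    show ?thesis using clause_correct[OF d vars] l by simp
  qed
  have start: "i \<le> length ?C \<Longrightarrow> drop (clause_start x i) x = ?L (drop i ?C)" for i
  proof (induction i)
    case 0
    then show ?case using x2 by (simp add: clause_start_def)
  next
    case (Suc i)
    then have "drop (clause_start x i) x = ?L (?C ! i # drop (Suc i) ?C)"
      by (simp add: Cons_nth_drop_Suc)
    from step[OF this] Suc.prems show ?case by (simp add: clause_start_def)
  qed
  \<comment> \<open>Every constraint is preceded by \<open>True\<close> and the list is closed by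
    \<open>False\<close>, so the loop test fails exactly after the last constraint.\<close>
  have count: "clause_count x = length ?C"
    unfolding clause_count_def
  proof (rule Least_equality)
    show "contents x (int (clause_start x (length ?C))) \<noteq> 2"
      using start[of "length ?C"] by (simp add: contents_drop enc_list_def)
    fix i assume i: "contents x (int (clause_start x i)) \<noteq> 2"
    show "length ?C \<le> i"
    proof (rule ccontr)
      assume "\<not> length ?C \<le> i"
      then have "drop (clause_start x i) x = ?L (?C ! i # drop (Suc i) ?C)"
        using start[of i] by (simp add: Cons_nth_drop_Suc)
      then show False using i by (simp add: contents_drop enc_list_def)
    qed
  qed
  have "clause_cells x (cells ?a ?e) (clause_start x i) = marked ?a ?e (?C ! i)" if "i < length ?C" for i
    using step[of "clause_start x i" "?C ! i" "drop (Suc i) ?C"] start[of i] that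
    by (simp add: Cons_nth_drop_Suc)
  then have "map (\<lambda>i. clause_rows (clause_cells x (cells ?a ?e) (clause_start x i))) [0..<length ?C] =
      map (\<lambda>C. clause_rows (marked ?a ?e C)) ?C"
    by (intro nth_equalityI) simp_all
  then show ?thesis
    unfolding x_def[symmetric]
    by (simp add: reduction_output_def cs count enc_crp_def mat_to_list_crp_matrix formula_rows_def
        enc_list_def[of "enc_list enc_rat"] enc_rows_def)
qed

theorem theorem4p6:
  fixes \<epsilon> :: real
  assumes "\<epsilon> > 0"
  shows "polytime_reducible forall_exists_nae_e3_sat (bin_gap_crp (9/8 - \<epsilon>))"
  using assms output_correct polytime_output by (rule reduction_correct)

end
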